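(* Let $Q$ and $\tilde Q$ be connected loop-less quivers with the same number $m$ of vertices and the same number $n$ of arrows. The following are equivalent: (i) $\Lambda_Q=\Lambda_{\tilde Q}$; (ii) there is an $n\times n$ integer matrix $B$ (not necessarily $\mathbb{Z}$-invertible) with $I(Q)B=I(\tilde Q)$ and $I(\tilde Q^{\dagger})B^{\mathrm{tr}}=I(Q^{\dagger})$; (iii) there is an $n\times n$ integer matrix $B$ (necessarily $\mathbb{Z}$-invertible) with $I(Q)B=I(\tilde Q)$ and $\check G_{\tilde Q}=B^{\mathrm{tr}}\check G_QB$.
   Context: A quiver $Q$ has vertex set $\{1,\dots,m\}$, arrow set $\{1,\dots,n\}$ and maps $s,t$ (source, target); it is loop-less if $s(i)\ne t(i)$ for all arrows $i$, connected if its underlying graph is connected. The incidence matrix $I(Q)$ is the $m\times n$ integer matrix whose $i$-th column is $\mathbf{e}_{s(i)}-\mathbf{e}_{t(i)}$. Let $G_Q=I(Q)^{\mathrm{tr}}I(Q)$ and $\check G_Q$ the unique upper triangular matrix with $\check G_Q+\check G_Q^{\mathrm{tr}}=G_Q$ (it has ones on the diagonal when $Q$ is loop-less). The inverse quiver $Q^\dagger$ of a connected loop-less quiver $Q$ is the quiver on the same vertices and arrows with incidence matrix $I(Q^\dagger)=I(Q)\check G_Q^{-1}$ (this matrix is known to be the incidence matrix of a connected loop-less quiver). The Coxeter–Laplacian of $Q$ is $\Lambda_Q=\mathrm{Id}_m-I(Q)\check G_Q^{-1}I(Q)^{\mathrm{tr}}$. *)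

theory Defs
  imports
    "Graph_Theory.Digraph_Component"
    "Jordan_Normal_Form.Determinant"
begin

text \<open>
  Quivers are multi-digraphs in the sense of the AFP entry \<^emph>\<open>Graph_Theory\<close>, with source map
  \<^const>\<open>tail\<close> and target map \<^const>\<open>head\<close>.  Vertices and arrows are numbered from \<open>0\<close>, to fit the
  indexing of the type \<^typ>\<open>int mat\<close>.
\<close>

definition quiver :: "nat \<Rightarrow> nat \<Rightarrow> (nat, nat) pre_digraph \<Rightarrow> bool" where
  "quiver m n Q \<longleftrightarrow> wf_digraph Q \<and> verts Q = {..<m} \<and> arcs Q = {..<n}"

definition incidence_mat :: "(nat, nat) pre_digraph \<Rightarrow> int mat" where
  "incidence_mat Q =
     (let m = card (verts Q); n = card (arcs Q)
      in mat_of_cols m (map (\<lambda>i. unit_vec m (tail Q i) - unit_vec m (head Q i)) [0..<n]))"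

definition gram_mat :: "(nat, nat) pre_digraph \<Rightarrow> int mat" where
  "gram_mat Q = transpose_mat (incidence_mat Q) * incidence_mat Q"

definition upper_gram_mat :: "(nat, nat) pre_digraph \<Rightarrow> int mat" where
  "upper_gram_mat Q =
     (THE U. U \<in> carrier_mat (card (arcs Q)) (card (arcs Q)) \<and> upper_triangular U \<and>
             U + transpose_mat U = gram_mat Q)"

definition mat_inv :: "int mat \<Rightarrow> int mat" where
  "mat_inv A =
     (THE B. B \<in> carrier_mat (dim_row A) (dim_row A) \<and> inverts_mat A B \<and> inverts_mat B A)"

text \<open>
  The incidence matrix of a loop-less quiver determines source and target of every arrow, but the
  record fields \<^const>\<open>tail\<close> and \<^const>\<open>head\<close> are total functions whose values outside
  the set of arrows are arbitrary; hence the choice operator rather than a definite description.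
\<close>

definition inverse_quiver :: "(nat, nat) pre_digraph \<Rightarrow> (nat, nat) pre_digraph" where
  "inverse_quiver Q =
     (SOME Q'. wf_digraph Q' \<and> verts Q' = verts Q \<and> arcs Q' = arcs Q \<and>
               incidence_mat Q' = incidence_mat Q * mat_inv (upper_gram_mat Q))"

definition coxeter_laplacian :: "(nat, nat) pre_digraph \<Rightarrow> int mat" where
  "coxeter_laplacian Q =
     1\<^sub>m (card (verts Q))
       - incidence_mat Q * mat_inv (upper_gram_mat Q) * transpose_mat (incidence_mat Q)"


subsection \<open>The descriptions above are well-defined\<close>

lemma incidence_mat_carrier:
  assumes "quiver m n Q"
  shows "incidence_mat Q \<in> carrier_mat m n"
  using assms by (simp add: quiver_def incidence_mat_def Let_def mat_of_cols_def)

lemma incidence_mat_index: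
  assumes "quiver m n Q" "i < m" "j < n"
  shows "incidence_mat Q $$ (i, j) = of_bool (i = tail Q j) - of_bool (i = head Q j)"
proof -
  interpret wf_digraph Q using assms(1) by (simp add: quiver_def)
  have "tail Q j < m" "head Q j < m"
    using assms tail_in_verts[of j] head_in_verts[of j] by (auto simp: quiver_def)
  then show ?thesis
    using assms by (auto simp: quiver_def incidence_mat_def Let_def mat_of_cols_index unit_vec_def)
qed

lemma gram_mat_carrier:
  assumes "quiver m n Q"
  shows "gram_mat Q \<in> carrier_mat n n"
  using incidence_mat_carrier[OF assms] by (simp add: gram_mat_def)

lemma gram_mat_index:
  assumes Q: "quiver m n Q" and ij: "i < n" "j < n"
  shows "gram_mat Q $$ (i, j) =
    incidence_mat Q $$ (tail Q j, i) - incidence_mat Q $$ (head Q j, i)"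
proof -
  interpret wf_digraph Q using Q by (simp add: quiver_def)
  have st: "tail Q j < m" "head Q j < m"
    using Q ij tail_in_verts[of j] head_in_verts[of j] by (auto simp: quiver_def)
  have "gram_mat Q $$ (i, j) = (\<Sum>k<m. incidence_mat Q $$ (k, i) * incidence_mat Q $$ (k, j))"
    using incidence_mat_carrier[OF Q] ij
    by (auto simp: gram_mat_def scalar_prod_def atLeast0LessThan intro!: sum.cong)
  also have "\<dots> = (\<Sum>k<m. (if k = tail Q j then incidence_mat Q $$ (k, i) else 0)
                        - (if k = head Q j then incidence_mat Q $$ (k, i) else 0))"
    using Q ij by (intro sum.cong) (auto simp: incidence_mat_index)
  also have "\<dots> = incidence_mat Q $$ (tail Q j, i) - incidence_mat Q $$ (head Q j, i)"
    using st by (simp add: sum_subtractf)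
  finally show ?thesis .
qed

lemma gram_mat_sym:
  assumes Q: "quiver m n Q" and ij: "i < n" "j < n"
  shows "gram_mat Q $$ (i, j) = gram_mat Q $$ (j, i)"
proof -
  have "transpose_mat (gram_mat Q) = gram_mat Q"
    using incidence_mat_carrier[OF Q] by (simp add: gram_mat_def transpose_mult)
  then show ?thesis
    using gram_mat_carrier[OF Q] ij by (metis carrier_matD index_transpose_mat(1))
qed

lemma gram_mat_diag:
  assumes Q: "quiver m n Q" and i: "i < n"
  shows "gram_mat Q $$ (i, i) = (if tail Q i = head Q i then 0 else 2)"
proof -
  interpret wf_digraph Q using Q by (simp add: quiver_def)
  have "tail Q i < m" "head Q i < m"
    using Q i tail_in_verts[of i] head_in_verts[of i] by (auto simp: quiver_def)
  then show ?thesis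
    using Q i by (simp add: gram_mat_index incidence_mat_index)
qed

lemma upper_gram_mat_eq:
  assumes Q: "quiver m n Q"
  defines "G \<equiv> gram_mat Q"
  defines "U \<equiv> mat n n (\<lambda>(i, j). if i < j then G $$ (i, j) else if i = j then G $$ (i, i) div 2 else 0)"
  shows "upper_gram_mat Q = U"
    and "\<exists>!U. U \<in> carrier_mat n n \<and> upper_triangular U \<and> U + transpose_mat U = gram_mat Q"
proof -
  have G: "G \<in> carrier_mat n n" unfolding G_def by (rule gram_mat_carrier[OF Q])
  have sum: "U + transpose_mat U = gram_mat Q"
  proof (rule eq_matI)
    fix i j assume "i < dim_row (gram_mat Q)" "j < dim_col (gram_mat Q)"
    then have ij: "i < n" "j < n" using G by (auto simp: G_def)
    consider "i < j" | "i = j" | "j < i" by linarith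
    then show "(U + transpose_mat U) $$ (i, j) = gram_mat Q $$ (i, j)"
      using ij gram_mat_sym[OF Q ij] gram_mat_diag[OF Q ij(1)]
      by cases (auto simp: U_def G_def)
  qed (use G in \<open>auto simp: U_def G_def\<close>)
  have uniq: "X = U"
    if X: "X \<in> carrier_mat n n" "upper_triangular X" "X + transpose_mat X = gram_mat Q" for X
  proof (rule eq_matI)
    fix i j assume "i < dim_row U" "j < dim_col U"
    then have ij: "i < n" "j < n" by (auto simp: U_def)
    have "gram_mat Q $$ (i, j) = X $$ (i, j) + X $$ (j, i)"
      using X(1) ij by (simp flip: X(3))
    moreover have "X $$ (k, l) = 0" if "k < n" "l < k" for k l
      using X(1,2) that by (auto dest: upper_triangularD)
    ultimately show "X $$ (i, j) = U $$ (i, j)"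
      using ij by (cases i j rule: linorder_cases) (auto simp: U_def G_def)
  qed (use X in \<open>auto simp: U_def\<close>)
  have U: "U \<in> carrier_mat n n" "upper_triangular U" by (auto simp: U_def)
  show ex1: "\<exists>!U. U \<in> carrier_mat n n \<and> upper_triangular U \<and> U + transpose_mat U = gram_mat Q"
    using U sum uniq by blast
  have "card (arcs Q) = n" using Q by (simp add: quiver_def)
  then show "upper_gram_mat Q = U"
    unfolding upper_gram_mat_def using the1_equality[OF ex1] U sum by blast
qed

lemma upper_gram_mat:
  assumes Q: "quiver m n Q" and "loopfree_digraph Q"
  shows "upper_gram_mat Q \<in> carrier_mat n n" "upper_triangular (upper_gram_mat Q)"
    and "upper_gram_mat Q + transpose_mat (upper_gram_mat Q) = gram_mat Q"
    and "\<And>i. i < n \<Longrightarrow> upper_gram_mat Q $$ (i, i) = 1"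
    and "\<And>i j. i < j \<Longrightarrow> j < n \<Longrightarrow> upper_gram_mat Q $$ (i, j) = gram_mat Q $$ (i, j)"
proof -
  interpret loopfree_digraph Q by fact
  note eq = upper_gram_mat_eq[OF Q]
  have "card (arcs Q) = n" using Q by (simp add: quiver_def)
  then show "upper_gram_mat Q + transpose_mat (upper_gram_mat Q) = gram_mat Q"
    unfolding upper_gram_mat_def using theI'[OF eq(2)] by simp
  show "upper_gram_mat Q \<in> carrier_mat n n" "upper_triangular (upper_gram_mat Q)"
    by (auto simp: eq(1))
  show "upper_gram_mat Q $$ (i, i) = 1" if "i < n" for i
  proof -
    have "tail Q i \<noteq> head Q i" using no_loops[of i] that Q by (simp add: quiver_def)
    then show ?thesis using that by (simp add: eq(1) gram_mat_diag[OF Q])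
  qed
  show "upper_gram_mat Q $$ (i, j) = gram_mat Q $$ (i, j)" if "i < j" "j < n" for i j
    using that by (simp add: eq(1))
qed

lemma mat_inv_eqI:
  assumes "A \<in> carrier_mat n n" "B \<in> carrier_mat n n" "A * B = 1\<^sub>m n" "B * A = 1\<^sub>m n"
  shows "mat_inv A = B"
  unfolding mat_inv_def
proof (rule the_equality)
  fix C assume "C \<in> carrier_mat (dim_row A) (dim_row A) \<and> inverts_mat A C \<and> inverts_mat C A"
  then have C: "C \<in> carrier_mat n n" "C * A = 1\<^sub>m n" using assms(1) by (auto simp: inverts_mat_def)
  have "C = C * (A * B)" using C assms(3) by simp
  also have "\<dots> = (C * A) * B" by (rule assoc_mult_mat[symmetric, OF C(1) assms(1,2)])
  also have "\<dots> = B" using C(2) assms(2) by simp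
  finally show "C = B" .
qed (use assms in \<open>auto simp: inverts_mat_def\<close>)

lemma mat_inv_upper_gram_mat:
  assumes Q: "quiver m n Q" and lf: "loopfree_digraph Q"
  defines "U \<equiv> upper_gram_mat Q"
  shows "mat_inv U \<in> carrier_mat n n" "U * mat_inv U = 1\<^sub>m n" "mat_inv U * U = 1\<^sub>m n"
proof -
  note U = upper_gram_mat[OF Q lf, folded U_def]
  have "diag_mat U = map (\<lambda>_. 1) [0..<n]"
    using U(1,4) by (auto simp: diag_mat_def)
  then have "prod_list (diag_mat U) = 1"
    by (simp add: map_replicate_const)
  then have "det U = 1"
    using det_upper_triangular[OF U(2,1)] by simp
  then have adj: "U * adj_mat U = 1\<^sub>m n" "adj_mat U * U = 1\<^sub>m n" "adj_mat U \<in> carrier_mat n n"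
    using adj_mat[OF U(1)] by auto
  then have "mat_inv U = adj_mat U" by (intro mat_inv_eqI[OF U(1)])
  with adj show "mat_inv U \<in> carrier_mat n n" "U * mat_inv U = 1\<^sub>m n" "mat_inv U * U = 1\<^sub>m n"
    by simp_all
qed

lemma inverse_quiver_exists:
  assumes Q: "quiver m n Q" and lf: "loopfree_digraph Q"
  shows "\<exists>Q'. wf_digraph Q' \<and> verts Q' = verts Q \<and> arcs Q' = arcs Q \<and>
              incidence_mat Q' = incidence_mat Q * mat_inv (upper_gram_mat Q)"
proof -
  interpret loopfree_digraph Q by fact
  define s t where "s = tail Q" and "t = head Q"
  have st: "s j < m" "t j < m" "s j \<noteq> t j" if "j < n" for j
    using Q that no_loops[of j] tail_in_verts[of j] head_in_verts[of j]
    by (auto simp: quiver_def s_def t_def)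
  define \<tau> where "\<tau> j x = (if x = s j then t j else if x = t j then s j else x)" for j x
  define p where "p = rec_nat (\<lambda>x. x) (\<lambda>j q x. q (\<tau> j x))"
  have p0: "p 0 x = x" and pS: "p (Suc j) x = p j (\<tau> j x)" for j x
    by (simp_all add: p_def)
  have p_less: "p j x < m" if "j \<le> n" "x < m" for j x
    using that
  proof (induction j arbitrary: x)
    case (Suc j)
    then show ?case using st[of j] by (auto simp: pS \<tau>_def)
  qed (simp add: p0)
  define Q' where "Q' = \<lparr>verts = verts Q, arcs = arcs Q, tail = (\<lambda>j. p j (s j)), head = (\<lambda>j. p j (t j))\<rparr>"
  have Q': "quiver m n Q'"
    using Q p_less st by (auto simp: quiver_def Q'_def intro!: wf_digraph.intro)
  define U where "U = upper_gram_mat Q"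
  define V where "V = incidence_mat Q"
  define W where "W = incidence_mat Q'"
  have V: "V \<in> carrier_mat m n" and W: "W \<in> carrier_mat m n"
    unfolding V_def W_def by (rule incidence_mat_carrier, fact)+
  have Vi: "V $$ (k, j) = of_bool (k = s j) - of_bool (k = t j)" if "k < m" "j < n" for k j
    using incidence_mat_index[OF Q that] by (simp add: V_def s_def t_def)
  have Wi: "W $$ (k, j) = of_bool (k = p j (s j)) - of_bool (k = p j (t j))" if "k < m" "j < n" for k j
    using incidence_mat_index[OF Q' that] by (simp add: W_def Q'_def)
  note U = upper_gram_mat[OF Q lf, folded U_def]
  note Uinv = mat_inv_upper_gram_mat[OF Q lf, folded U_def]
  have key: "of_bool (k = p j x) = (of_bool (k = x) :: int) - (\<Sum>i<j. W $$ (k, i) * V $$ (x, i))"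
    if "k < m" "j \<le> n" "x < m" for k j x
    using that
  proof (induction j arbitrary: x)
    case (Suc j)
    have "of_bool (k = p (Suc j) x) - of_bool (k = p j x) = - W $$ (k, j) * V $$ (x, j)"
      using Suc.prems st[of j] by (auto simp: pS \<tau>_def Wi Vi)
    then show ?case using Suc by simp
  qed (simp add: p0)
  have "W * U = V"
  proof (rule eq_matI)
    fix k j assume "k < dim_row V" "j < dim_col V"
    then have kj: "k < m" "j < n" using V by auto
    have "(W * U) $$ (k, j) = (\<Sum>i<n. W $$ (k, i) * U $$ (i, j))"
      using W U(1) kj by (auto simp: scalar_prod_def atLeast0LessThan intro!: sum.cong)
    also have "\<dots> = (\<Sum>i<Suc j. W $$ (k, i) * U $$ (i, j))"
      using kj U(1) by (intro sum.mono_neutral_right) (auto simp: upper_triangularD[OF U(2)])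
    also have "\<dots> = (\<Sum>i<j. W $$ (k, i) * U $$ (i, j)) + W $$ (k, j)"
      using U(4) kj by simp
    also have "(\<Sum>i<j. W $$ (k, i) * U $$ (i, j))
        = (\<Sum>i<j. W $$ (k, i) * (V $$ (s j, i) - V $$ (t j, i)))"
      using kj U(5) gram_mat_index[OF Q] by (intro sum.cong) (auto simp: V_def s_def t_def)
    also have "\<dots> = (\<Sum>i<j. W $$ (k, i) * V $$ (s j, i)) - (\<Sum>i<j. W $$ (k, i) * V $$ (t j, i))"
      by (simp add: right_diff_distrib sum_subtractf)
    also have "\<dots> + W $$ (k, j) = V $$ (k, j)"
      using key[of k j "s j"] key[of k j "t j"] st[of j] kj by (simp add: Vi Wi)
    finally show "(W * U) $$ (k, j) = V $$ (k, j)" .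
  qed (use V W U in auto)
  then have "V * mat_inv U = W * (U * mat_inv U)"
    using assoc_mult_mat[OF W U(1) Uinv(1)] by simp
  then have "W = V * mat_inv U" using W Uinv by simp
  then show ?thesis
    using Q' by (intro exI[of _ Q']) (auto simp: quiver_def U_def V_def W_def Q'_def)
qed

lemma inverse_quiver:
  assumes Q: "quiver m n Q" and lf: "loopfree_digraph Q"
  shows "quiver m n (inverse_quiver Q)"
    and "incidence_mat (inverse_quiver Q) = incidence_mat Q * mat_inv (upper_gram_mat Q)"
  using someI_ex[OF inverse_quiver_exists[OF assms]] Q
  by (auto simp: inverse_quiver_def[symmetric] quiver_def)

end

theory Submission
  imports Defs
    "HOL-Library.Function_Algebras"
    "HOL-Library.Product_Plus"
    "HOL-Computational_Algebra.Group_Closure"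
    "HOL-Combinatorics.Orbits"
begin

text \<open>
  The hard implication is from equal Coxeter--Laplacians to the congruence. Let \<open>b x y = x\<^sup>T U y\<close>
  be the unimodular form on \<open>\<int>\<^sup>n\<close> given by the triangular Gram matrix \<open>U\<close>, and \<open>I\<close> the incidence matrix.
  The Coxeter--Laplacian is the matrix of a permutation \<open>p\<close> (a product of transpositions), and the
  vectors \<open>v\<^sub>a = U\<^sup>-\<^sup>1 I\<^sup>T e\<^sub>a\<close> satisfy \<open>b x v\<^sub>a = (I x)\<^sub>a\<close> and \<open>I v\<^sub>a = e\<^sub>a - e\<^bsub>p(a)\<^esub>\<close>: their
  Gram matrix and images only depend on \<open>p\<close>. For each cycle of \<open>p\<close> but one, choose a representative
  \<open>c\<close> and a lift of \<open>e\<^sub>c - e\<^sub>0\<close> along \<open>I\<close>, where \<open>e\<^sub>0\<close> belongs to the remaining cycle. The sums of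
  \<open>v\<^sub>a\<close> over the cycles lie in the kernel of \<open>I\<close> and are dual to these lifts, so the lifts can
  be corrected to have any Gram matrix compatible with \<open>I\<close>. The orthogonal complement of all
  these vectors is a unimodular alternating lattice, hence a sum of hyperbolic planes. Matching up
  such generators for the two quivers gives an isometry over \<open>I\<close>.
\<close>

section \<open>Subgroups generated by sets, and lifting along projections\<close>

lemma group_closure_sum:
  assumes "\<And>j. j \<in> J \<Longrightarrow> f j \<in> group_closure A"
  shows "sum f J \<in> group_closure A"
  using assms by (induction J rule: infinite_finite_induct) (auto intro: group_closure_add)

lemma group_closure_mono: "A \<subseteq> B \<Longrightarrow> group_closure A \<subseteq> group_closure B"
proof
  fix x assume "x \<in> group_closure A" and "A \<subseteq> B"
  then show "x \<in> group_closure B"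
    by induction (auto intro: group_closure.intros)
qed

lemma group_closure_base': "x \<in> A \<Longrightarrow> x \<in> group_closure A"
  by (simp add: group_closure.base)

text \<open>Zero lifts to the zero pair and differences lift componentwise. In
  \<open>isometry\<close> this turns a vector of the first span into a pair whose second component
  is its image.\<close>

lemma group_closure_fst_lift:
  fixes G :: "('a::ab_group_add \<times> 'b::ab_group_add) set"
  assumes "x \<in> group_closure (fst ` G)"
  shows "\<exists>y. (x, y) \<in> group_closure G"
  using assms
proof induction
  case (base s)
  show ?case
  proof (cases "s = 0")
    case True
    then show ?thesis using zero_in_group_closure[of G] by (auto simp: zero_prod_def)
  next
    case False
    then obtain y where "(s, y) \<in> G" using base by auto
    then show ?thesis using group_closure_base' by blast
  qed
next
  case (diff s t)
  then show ?case using group_closure.diff[of "(s, _)" G "(t, _)"] by fastforce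
qed

lemma group_closure_snd_lift:
  fixes G :: "('a::ab_group_add \<times> 'b::ab_group_add) set"
  assumes "y \<in> group_closure (snd ` G)"
  shows "\<exists>x. (x, y) \<in> group_closure G"
  using assms
proof induction
  case (base s)
  show ?case
  proof (cases "s = 0")
    case True
    then show ?thesis using zero_in_group_closure[of G] by (auto simp: zero_prod_def)
  next
    case False
    then obtain x where "(x, s) \<in> G" using base by auto
    then show ?thesis using group_closure_base' by blast
  qed
next
  case (diff s t)
  then show ?case using group_closure.diff[of "(_, s)" G "(_, t)"] by fastforce
qed

section \<open>Representatives of the cycles of a permutation\<close>

text \<open>The choice depends on \<open>a\<close> only through the set \<open>orbit p a\<close>;
  for a permutation this set is the cycle of \<open>a\<close>, so the representative is constant on
  cycles.\<close>

definition cycle_rep :: "(nat \<Rightarrow> nat) \<Rightarrow> nat \<Rightarrow> nat" where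
  "cycle_rep p a = (SOME x. x \<in> orbit p a)"

lemma cycle_rep_orbit: "cycle_rep p a \<in> orbit p a"
  unfolding cycle_rep_def using orbit.base by (rule someI)

lemma cycle_rep_step: "permutation p \<Longrightarrow> cycle_rep p (p a) = cycle_rep p a"
  by (simp add: cycle_rep_def permutation_orbit_step)

lemma in_orbit_cycle_rep: "permutation p \<Longrightarrow> a \<in> orbit p (cycle_rep p a)"
  by (rule orbit_swap[OF permutation_self_in_orbit cycle_rep_orbit])

lemma cycle_rep_idem:
  assumes "permutation p"
  shows "cycle_rep p (cycle_rep p a) = cycle_rep p a"
proof -
  have "cycle_rep p x = cycle_rep p a" if "x \<in> orbit p a" for x
    using that by induction (simp_all add: cycle_rep_step[OF assms])
  then show ?thesis using cycle_rep_orbit by blast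
qed

lemma sum_of_bool_pick:
  fixes f :: "nat \<Rightarrow> int"
  assumes "finite S"
  shows "(\<Sum>k\<in>S. f k * of_bool (k = a)) = (if a \<in> S then f a else 0)"
    and "(\<Sum>k\<in>S. f k * of_bool (a = k)) = (if a \<in> S then f a else 0)"
    and "(\<Sum>k\<in>S. of_bool (k = a)) = (if a \<in> S then 1 else 0 :: int)"
    and "(\<Sum>k\<in>S. of_bool (a = k)) = (if a \<in> S then 1 else 0 :: int)"
proof -
  have *: "f k * of_bool (k = a) = (if k = a then f k else 0)"
    "f k * of_bool (a = k) = (if a = k then f k else 0)" for k by auto
  have **: "of_bool (k = a) = (if k = a then 1 else 0 :: int)"
    "of_bool (a = k) = (if a = k then 1 else 0 :: int)" for k by auto
  show "(\<Sum>k\<in>S. f k * of_bool (k = a)) = (if a \<in> S then f a else 0)"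
    "(\<Sum>k\<in>S. f k * of_bool (a = k)) = (if a \<in> S then f a else 0)"
    unfolding * using assms by simp_all
  show "(\<Sum>k\<in>S. of_bool (k = a)) = (if a \<in> S then 1 else 0 :: int)"
    "(\<Sum>k\<in>S. of_bool (a = k)) = (if a \<in> S then 1 else 0 :: int)"
    unfolding ** using assms by simp_all
qed

section \<open>Unimodular forms over an incidence map\<close>

text \<open>By \<open>b_units\<close> and \<open>unimodular\<close>, sending \<open>x\<close> to the
  values \<open>b x (e i)\<close> maps onto all integer tuples of length \<open>n\<close>, and its
  kernel is the left radical of \<open>b\<close>. This radical may be nonzero, so vectors are
  compared only up to it.\<close>

locale incidence_form = Modules.module scale
  for scale :: "int \<Rightarrow> 'v::ab_group_add \<Rightarrow> 'v" +
  fixes m n :: nat and p :: "nat \<Rightarrow> nat" and e :: "nat \<Rightarrow> 'v"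
    and b :: "'v \<Rightarrow> 'v \<Rightarrow> int" and inc :: "'v \<Rightarrow> nat \<Rightarrow> int" and v :: "nat \<Rightarrow> 'v"
  assumes m_pos: "0 < m" and p: "p permutes {..<m}"
    and b_add_left: "b (x + y) z = b x z + b y z"
    and b_add_right: "b z (x + y) = b z x + b z y"
    and b_scale_left: "b (scale r x) y = r * b x y"
    and b_scale_right: "b x (scale r y) = r * b x y"
    and b_units: "\<exists>f. \<forall>x. b x y = (\<Sum>i<n. f i * b x (e i))"
    and inc_add: "inc (x + y) k = inc x k + inc y k"
    and inc_scale: "inc (scale r x) k = r * inc x k"
    and unimodular: "\<exists>x. \<forall>i<n. b x (e i) = f i"
    and b_sym: "b x y + b y x = (\<Sum>k<m. inc x k * inc y k)"
    and sum_inc: "(\<Sum>k<m. inc x k) = 0"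
    and inc_surj: "a < m \<Longrightarrow> c < m \<Longrightarrow>
      \<exists>x. \<forall>k<m. inc x k = of_bool (k = a) - of_bool (k = c)"
    and b_v: "a < m \<Longrightarrow> b x (v a) = inc x a"
    and inc_v: "a < m \<Longrightarrow> k < m \<Longrightarrow> inc (v a) k = of_bool (k = a) - of_bool (k = p a)"
begin

lemma group_closure_scale:
  assumes "x \<in> group_closure A"
  shows "scale r x \<in> group_closure A"
proof (induction r rule: int_induct[where k = 0])
  case base
  then show ?case by simp
next
  case (step1 i)
  then show ?case using assms by (simp add: scale_left_distrib group_closure_add)
next
  case (step2 i)
  then show ?case using assms by (simp add: scale_left_diff_distrib group_closure.diff)
qed

sublocale bl: additive "\<lambda>x. b x y" for y
  by standard (rule b_add_left)

sublocale br: additive "b x" for x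
  by standard (rule b_add_right)

sublocale il: additive "\<lambda>x. inc x k" for k
  by standard (rule inc_add)

lemmas lin = bl.add bl.diff bl.zero bl.sum br.add br.diff br.zero br.sum
  il.add il.diff il.zero il.sum b_scale_left b_scale_right inc_scale

lemma perm: "permutation p"
  using p by (auto simp: permutation_permutes)

lemma p_less: "a < m \<Longrightarrow> p a < m"
  using permutes_in_image[OF p] by simp

lemma rep_less: "a < m \<Longrightarrow> cycle_rep p a < m"
  using permutes_orbit_subset[OF p, of a] cycle_rep_orbit[of p a] by auto

lemma anti:
  assumes "\<And>k. k < m \<Longrightarrow> inc x k = 0"
  shows "b x y = - b y x" "b y x = - b x y"
  using b_sym[of x y] assms by auto

text \<open>The symmetrized form is determined by \<open>inc\<close>, so the left pairing follows
  from the right one as \<open>inc x a - inc x (p a) - inc x a\<close>. Hence pairings with the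
  \<open>v a\<close> agree automatically for vectors with equal images under
  \<open>inc\<close>.\<close>

lemma b_v_left:
  assumes "a < m"
  shows "b (v a) x = - inc x (p a)"
proof -
  have "(\<Sum>k<m. inc (v a) k * inc x k)
      = (\<Sum>k<m. inc x k * of_bool (k = a) - inc x k * of_bool (k = p a))"
    using assms by (intro sum.cong) (auto simp: inc_v)
  also have "\<dots> = inc x a - inc x (p a)"
    using assms by (simp add: sum_subtractf sum_of_bool_pick p_less)
  finally show ?thesis using b_sym[of "v a" x] b_v[OF assms, of x] by simp
qed

definition cycle_vec :: "nat \<Rightarrow> 'v" where
  "cycle_vec c = (\<Sum>a\<in>{a\<in>{..<m}. cycle_rep p a = c}. v a)"

text \<open>Since \<open>p\<close> maps each cycle bijectively to itself, the two indicator sums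
  coming from \<open>inc_v\<close> cancel.\<close>

lemma inc_cycle_vec:
  assumes "k < m"
  shows "inc (cycle_vec c) k = 0"
proof -
  let ?S = "{a\<in>{..<m}. cycle_rep p a = c}"
  have inj: "inj_on p ?S" using permutes_inj[OF p] by (rule inj_on_subset) simp
  have "p ` ?S \<subseteq> ?S" using p_less by (auto simp: cycle_rep_step[OF perm])
  then have im: "p ` ?S = ?S" using inj by (intro endo_inj_surj) auto
  have "inc (cycle_vec c) k = (\<Sum>a\<in>?S. of_bool (k = a)) - (\<Sum>a\<in>?S. of_bool (k = p a))"
    unfolding cycle_vec_def il.sum sum_subtractf[symmetric] using assms
    by (intro sum.cong) (auto simp: inc_v)
  also have "(\<Sum>a\<in>?S. of_bool (k = p a)) = (\<Sum>a\<in>p ` ?S. of_bool (k = a) :: int)"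
    using inj by (simp only: sum.reindex comp_def)
  finally show ?thesis using im by simp
qed

lemma b_cycle_vec: "b x (cycle_vec c) = (\<Sum>a\<in>{a\<in>{..<m}. cycle_rep p a = c}. inc x a)"
  by (simp add: cycle_vec_def lin b_v)

lemma b_cycle_vec_kernel:
  assumes "\<And>k. k < m \<Longrightarrow> inc x k = 0"
  shows "b x (cycle_vec c) = 0" "b (cycle_vec c) x = 0"
  using assms anti[OF assms, of "cycle_vec c"] by (auto simp: b_cycle_vec)

definition base :: nat where "base = cycle_rep p 0"

text \<open>One cycle is left out because the entries of \<open>inc x\<close> sum to 0: differences
  from \<open>base\<close> already generate all images.\<close>

definition reps :: "nat set" where "reps = cycle_rep p ` {..<m} - {base}"

lemma finite_reps: "finite reps"
  by (simp add: reps_def)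

lemma base_less: "base < m"
  using rep_less m_pos by (simp add: base_def)

lemma reps_less: "c \<in> reps \<Longrightarrow> c < m"
  using rep_less by (auto simp: reps_def)

text \<open>Pairing with a cycle vector adds up the entries of \<open>inc t\<close> over that cycle.
  The entry -1 at \<open>base\<close> lies outside, as the cycle of \<open>base\<close> is excluded
  from \<open>reps\<close>. The other order changes the sign by \<open>anti\<close>.\<close>

lemma b_lift_cycle_vec:
  assumes t: "\<And>k. k < m \<Longrightarrow> inc t k = of_bool (k = d) - of_bool (k = base)"
    and "c \<in> reps" "d \<in> reps"
  shows "b t (cycle_vec c) = of_bool (c = d)" "b (cycle_vec c) t = - of_bool (c = d)"
proof -
  have rep: "cycle_rep p d = d" "cycle_rep p base = base" "c \<noteq> base"
    using assms(2,3) by (auto simp: reps_def base_def cycle_rep_idem[OF perm])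
  have "b t (cycle_vec c) = (\<Sum>a\<in>{a\<in>{..<m}. cycle_rep p a = c}. of_bool (a = d) - of_bool (a = base))"
    unfolding b_cycle_vec by (intro sum.cong) (auto simp: t)
  also have "\<dots> = of_bool (c = d)"
    using rep reps_less[OF assms(3)] by (auto simp: sum_subtractf sum_of_bool_pick)
  finally show "b t (cycle_vec c) = of_bool (c = d)" .
  then show "b (cycle_vec c) t = - of_bool (c = d)"
    using anti(1)[OF inc_cycle_vec, of c t] by simp
qed

section \<open>Orthogonal complements and hyperbolic planes\<close>

text \<open>Only the left pairing is required to vanish. Once \<open>A\<close> contains all
  \<open>v a\<close>, \<open>perp_inc\<close> shows that \<open>inc\<close> kills the complement,
  and \<open>anti\<close> makes the orthogonality two-sided.\<close>

definition perp :: "'v set \<Rightarrow> 'v set" where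
  "perp A = {x. \<forall>y\<in>A. b x y = 0}"

definition splits :: "'v set \<Rightarrow> bool" where
  "splits A \<longleftrightarrow> (\<forall>x. \<exists>y\<in>group_closure A. x - y \<in> perp A)"

lemma perp_group_closure:
  assumes "x \<in> perp A" "y \<in> group_closure A"
  shows "b x y = 0"
  using assms(2,1) by induction (auto simp: perp_def lin)

lemma perp_inc:
  assumes "v ` {..<m} \<subseteq> A" "x \<in> perp A" "k < m"
  shows "inc x k = 0"
  using assms b_v[of k x] by (auto simp: perp_def)

text \<open>Subtracting the \<open>v x\<close> one after the other walks along a cycle, starting
  from its representative; adding \<open>t\<close> of the representative connects its cycle to
  \<open>base\<close>.\<close>

lemma vertex_lift:
  assumes v: "v ` {..<m} \<subseteq> A"
    and t: "\<And>c. c \<in> reps \<Longrightarrow> t c \<in> A"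
      "\<And>c k. c \<in> reps \<Longrightarrow> k < m \<Longrightarrow> inc (t c) k = of_bool (k = c) - of_bool (k = base)"
    and a: "a < m"
  shows "\<exists>w\<in>group_closure A. \<forall>k<m. inc w k = of_bool (k = a) - of_bool (k = base)"
proof -
  let ?r = "cycle_rep p a"
  have r: "?r < m" using rep_less a by blast
  have "\<exists>u\<in>group_closure A. \<forall>k<m. inc u k = of_bool (k = x) - of_bool (k = ?r)"
    if "x \<in> orbit p ?r" for x
    using that
  proof induction
    \<comment> \<open>The orbit induction starts at \<open>p ?r\<close>, which is one step away from
      \<open>?r\<close> already.\<close>
    case base
    have "- v ?r \<in> group_closure A" using v r by (auto intro: group_closure_base')
    then show ?case using r by (intro bexI[of _ "- v ?r"]) (auto simp: il.minus inc_v)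
  next
    case (step x)
    have x: "x < m" using permutes_orbit_subset[OF p, of ?r] r step(1) by auto
    from step obtain u where u: "u \<in> group_closure A"
      "\<And>k. k < m \<Longrightarrow> inc u k = of_bool (k = x) - of_bool (k = ?r)" by blast
    have "u - v x \<in> group_closure A"
      using v x u(1) by (auto intro!: group_closure.diff intro: group_closure_base')
    then show ?case using x u(2) by (intro bexI[of _ "u - v x"]) (auto simp: lin inc_v)
  qed
  then obtain u where u: "u \<in> group_closure A"
    "\<And>k. k < m \<Longrightarrow> inc u k = of_bool (k = a) - of_bool (k = ?r)"
    using in_orbit_cycle_rep[OF perm, of a] by blast
  show ?thesis
  proof (cases "?r = base")
    case True
    then show ?thesis using u by (intro bexI[of _ u]) simp_all
  next
    case False
    then have "?r \<in> reps" using a by (auto simp: reps_def)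
    then show ?thesis using u t
      by (intro bexI[of _ "u + t ?r"]) (auto simp: lin intro: group_closure_add group_closure_base')
  qed
qed

text \<open>The vector \<open>x\<close> is corrected twice: first by lifts of vertices, to kill its
  image under \<open>inc\<close> and so its pairings with the \<open>v a\<close>; then by cycle
  vectors, to kill the pairings with the \<open>t c\<close> without changing the image.\<close>

lemma splits_lifts:
  assumes t: "\<And>c k. c \<in> reps \<Longrightarrow> k < m \<Longrightarrow> inc (t c) k = of_bool (k = c) - of_bool (k = base)"
  shows "splits (v ` {..<m} \<union> t ` reps)"
  unfolding splits_def
proof
  fix x
  let ?A = "v ` {..<m} \<union> t ` reps"
  have "\<forall>a\<in>{..<m}. \<exists>w. w \<in> group_closure ?A \<and> (\<forall>k<m. inc w k = of_bool (k = a) - of_bool (k = base))"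
    using vertex_lift[of ?A t] t by blast
  then obtain w where w: "\<And>a. a < m \<Longrightarrow> w a \<in> group_closure ?A"
    "\<And>a k. a < m \<Longrightarrow> k < m \<Longrightarrow> inc (w a) k = of_bool (k = a) - of_bool (k = base)"
    by (metis lessThan_iff)
  \<comment> \<open>This has the same image as \<open>x\<close>: the multiples of the unit vector at
    \<open>base\<close> cancel by \<open>sum_inc\<close>.\<close>
  define f where "f = (\<Sum>a<m. scale (inc x a) (w a))"
  have f: "f \<in> group_closure ?A"
    unfolding f_def by (intro group_closure_sum group_closure_scale w) simp
  have x1: "inc (x - f) k = 0" if "k < m" for k
  proof -
    have "inc f k = (\<Sum>a<m. inc x a * of_bool (k = a) - inc x a * of_bool (k = base))"
      using that by (simp add: f_def lin w right_diff_distrib)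
    also have "\<dots> = inc x k - (\<Sum>a<m. inc x a) * of_bool (k = base)"
      using that by (simp add: sum_subtractf sum_of_bool_pick sum_distrib_right)
    finally show ?thesis by (simp add: lin sum_inc)
  qed
  \<comment> \<open>The plus sign in \<open>x - f + g\<close> is due to the pairing -1 of
    \<open>cycle_vec c\<close> with \<open>t c\<close> in this order.\<close>
  define g where "g = (\<Sum>c\<in>reps. scale (b (x - f) (t c)) (cycle_vec c))"
  have "cycle_vec c \<in> group_closure ?A" for c
    unfolding cycle_vec_def by (intro group_closure_sum) (auto intro: group_closure_base')
  then have g: "g \<in> group_closure ?A"
    unfolding g_def by (intro group_closure_sum group_closure_scale)
  have "b (x - f + g) (t d) = 0" if "d \<in> reps" for d
  proof -
    have "b g (t d) = (\<Sum>c\<in>reps. - (b (x - f) (t c) * of_bool (c = d)))"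
      unfolding g_def using t that by (auto simp: lin b_lift_cycle_vec intro!: sum.cong)
    also have "\<dots> = - b (x - f) (t d)"
      using that finite_reps by (simp only: sum_negf sum_of_bool_pick if_True)
    finally show ?thesis by (simp add: lin)
  qed
  moreover have "b (x - f + g) (v a) = 0" if "a < m" for a
    using that x1 by (simp add: b_v g_def lin inc_cycle_vec)
  ultimately have "x - (f - g) \<in> perp ?A"
    by (auto simp: perp_def algebra_simps)
  then show "\<exists>y\<in>group_closure ?A. x - y \<in> perp ?A"
    using f g by (intro bexI[of _ "f - g"]) (auto intro: group_closure.diff)
qed

lemma splits_insert_hyperbolic:
  assumes "splits A" and v: "v ` {..<m} \<subseteq> A"
    and h: "h \<in> perp A" "h' \<in> perp A" "b h h' = 1"
  shows "splits (insert h (insert h' A))"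
  unfolding splits_def
proof
  fix x
  let ?A = "insert h (insert h' A)"
  obtain y where y: "y \<in> group_closure A" "x - y \<in> perp A"
    using assms(1) by (auto simp: splits_def)
  define z where "z = x - y"
  \<comment> \<open>The orthogonal projection of \<open>z\<close> to the plane spanned by
    \<open>h\<close> and \<open>h'\<close>, whose alternating form has determinant 1.\<close>
  define w where "w = scale (b z h') h - scale (b z h) h'"
  have "b h' h = -1" "b h h = 0" "b h' h' = 0"
    using anti[OF perp_inc[OF v h(1)]] anti[OF perp_inc[OF v h(2)]] h(3)
    by (smt (verit))+
  then have "z - w \<in> perp ?A"
    using h y(2) unfolding perp_def w_def z_def[symmetric] by (auto simp: lin)
  moreover have "w \<in> group_closure ?A" unfolding w_def
    by (intro group_closure.diff group_closure_scale group_closure_base') auto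
  moreover have "y \<in> group_closure ?A" using y(1) group_closure_mono[of A ?A] by auto
  ultimately show "\<exists>y\<in>group_closure ?A. x - y \<in> perp ?A"
    by (intro bexI[of _ "y + w"]) (auto simp: z_def algebra_simps intro: group_closure_add)
qed

text \<open>The values of \<open>b k\<close> are the multiples of a positive \<open>d\<close>. By
  unimodularity the functional \<open>b k\<close> divided by \<open>d\<close> is represented by some
  \<open>h\<close>, which takes the value 1.\<close>

lemma hyperbolic_pair:
  assumes "splits A" "k \<in> perp A" "b k y \<noteq> 0"
  obtains h h' where "h \<in> perp A" "h' \<in> perp A" "b h h' = 1"
proof -
  let ?P = "\<lambda>d. 0 < d \<and> (\<exists>y. b k y = int d)"
  define d where "d = (LEAST d. ?P d)"
  have "b k (scale (sgn (b k y)) y) = int (nat \<bar>b k y\<bar>)"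
    by (simp add: lin abs_sgn[symmetric] mult.commute)
  then have "?P (nat \<bar>b k y\<bar>)" using assms(3) by auto
  then have "?P d" unfolding d_def by (rule LeastI)
  then obtain y0 where d: "0 < d" and y0: "b k y0 = int d" by blast
  \<comment> \<open>Otherwise a remainder modulo \<open>d\<close> would be a smaller positive value
    of \<open>b k\<close>.\<close>
  have dvd: "int d dvd b k z" for z
  proof (rule ccontr)
    assume "\<not> int d dvd b k z"
    then have "b k z mod int d \<noteq> 0" by (simp add: dvd_eq_mod_eq_0)
    moreover have "0 \<le> b k z mod int d" using d by simp
    ultimately have pos: "0 < b k z mod int d" by linarith
    have "b k (z - scale (b k z div int d) y0) = b k z mod int d"
      by (simp add: lin y0 minus_div_mult_eq_mod)
    then have "?P (nat (b k z mod int d))" using pos by auto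
    then have "d \<le> nat (b k z mod int d)" unfolding d_def by (rule Least_le)
    moreover have "b k z mod int d < int d" using d by simp
    ultimately show False using pos by linarith
  qed
  obtain h where h: "\<And>i. i < n \<Longrightarrow> b h (e i) = b k (e i) div int d"
    using unimodular[of "\<lambda>i. b k (e i) div int d"] by blast
  have hk: "int d * b h z = b k z" for z
  proof -
    obtain f where f: "\<And>x. b x z = (\<Sum>i<n. f i * b x (e i))" using b_units by blast
    have "int d * b h z = (\<Sum>i<n. f i * (int d * b h (e i)))"
      by (simp add: f sum_distrib_left mult.left_commute)
    also have "\<dots> = b k z"
      unfolding f using h dvd by (intro sum.cong) auto
    finally show ?thesis .
  qed
  have "b h z = 0" if "z \<in> A" for z
    using hk[of z] assms(2) that d by (simp add: perp_def)
  then have hA: "h \<in> perp A" by (simp add: perp_def)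
  \<comment> \<open>The component \<open>y0 - f\<close> in the complement serves as
    \<open>h'\<close>; subtracting \<open>f\<close> does not change the pairing with
    \<open>h\<close>.\<close>
  obtain f where f: "f \<in> group_closure A" "y0 - f \<in> perp A"
    using assms(1) by (auto simp: splits_def)
  have "b h y0 = 1" using hk[of y0] y0 d by simp
  then have "b h (y0 - f) = 1" using perp_group_closure[OF hA f(1)] by (simp add: lin)
  with hA f(2) that show thesis by blast
qed

text \<open>Encodes the functional \<open>b x\<close> modulo 2 by a subset of \<open>{..<n}\<close>,
  so that infinite complements can be measured by a cardinality.\<close>

definition parity :: "'v \<Rightarrow> nat set" where
  "parity x = {i. i < n \<and> odd (b x (e i))}"

lemma parity_eqD:
  assumes "parity x = parity y"
  shows "even (b x z) \<longleftrightarrow> even (b y z)"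
proof -
  obtain f where f: "\<And>x. b x z = (\<Sum>i<n. f i * b x (e i))" using b_units by blast
  have "even (b x (e i) - b y (e i))" if "i < n" for i
    using assms that by (auto simp: parity_def set_eq_iff)
  then have "even (\<Sum>i<n. f i * (b x (e i) - b y (e i)))"
    by (intro dvd_sum) auto
  moreover have "\<dots> = b x z - b y z"
    by (simp add: f sum_subtractf right_diff_distrib)
  ultimately show ?thesis by simp
qed

lemma finite_parity: "finite (parity ` X)"
  by (rule finite_subset[of _ "Pow {..<n}"]) (auto simp: parity_def)

text \<open>Termination of the splitting: the complement shrinks modulo 2, since \<open>b h h' = 1\<close> is odd.\<close>

lemma parity_perp_decreases:
  assumes "h \<in> perp A" "b h h' = 1"
  shows "card (parity ` perp (insert h (insert h' A))) < card (parity ` perp A)"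
proof (rule psubset_card_mono[OF finite_parity])
  have "parity h \<notin> parity ` perp (insert h (insert h' A))"
  proof
    assume "parity h \<in> parity ` perp (insert h (insert h' A))"
    then obtain z where "parity h = parity z" "b z h' = 0" by (auto simp: perp_def)
    then show False using parity_eqD[of h z h'] assms(2) by simp
  qed
  moreover have "parity h \<in> parity ` perp A" using assms(1) by simp
  moreover have "perp (insert h (insert h' A)) \<subseteq> perp A" by (auto simp: perp_def)
  ultimately show "parity ` perp (insert h (insert h' A)) \<subset> parity ` perp A" by blast
qed

end

section \<open>Matching two forms with the same permutation\<close>

locale incidence_form_pair =
  F: incidence_form scale m n p e b inc v + F': incidence_form scale' m n p e' b' inc' v'
  for scale :: "int \<Rightarrow> 'v::ab_group_add \<Rightarrow> 'v" and scale' :: "int \<Rightarrow> 'w::ab_group_add \<Rightarrow> 'w"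
    and m n p e b inc v e' b' inc' v'
begin

text \<open>A partial isometry over \<open>inc\<close>, given by its graph. The graph need not be
  single-valued, so generators can be paired without checking relations between them.\<close>

definition compatible :: "('v \<times> 'w) set \<Rightarrow> bool" where
  "compatible G \<longleftrightarrow> (\<forall>(x, x')\<in>G. (\<forall>k<m. inc x k = inc' x' k) \<and> (\<forall>(y, y')\<in>G. b x y = b' x' y'))"

lemma compatible_group_closure:
  assumes "compatible G"
  shows "compatible (group_closure G)"
proof -
  have 1: "\<forall>k<m. inc (fst s) k = inc' (snd s) k" if "s \<in> group_closure G" for s
    using that
  proof induction
    case (base s) then show ?case using assms by (auto simp: compatible_def F.lin F'.lin)
  qed (simp add: F.lin F'.lin)
  have 2: "b (fst s) (fst t) = b' (snd s) (snd t)" if "s \<in> group_closure G" "t \<in> G" for s t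
    using that
  proof induction
    case (base s) then show ?case using assms
      by (cases s; cases t) (auto simp: compatible_def zero_prod_def F.lin F'.lin)
  qed (simp add: F.lin F'.lin)
  have "b (fst s) (fst t) = b' (snd s) (snd t)" if "t \<in> group_closure G" "s \<in> group_closure G" for s t
    using that
  proof induction
    case (base t) then show ?case using 2[of s t] by (auto simp: F.lin F'.lin)
  qed (simp add: F.lin F'.lin)
  with 1 show ?thesis by (fastforce simp: compatible_def)
qed

lemma b_sym_transfer:
  assumes "\<And>k. k < m \<Longrightarrow> inc x k = inc' x' k" "\<And>k. k < m \<Longrightarrow> inc y k = inc' y' k"
  shows "b x y + b y x = b' x' y' + b' y' x'"
  using assms by (simp add: F.b_sym F'.b_sym)

text \<open>The \<open>v a\<close> match because their pairings and images depend only on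
  \<open>p\<close>. Lifts on the second side are kept as chosen; those on the first side are
  corrected by cycle vectors to have the same Gram matrix.\<close>

lemma initial_pairs:
  obtains G where "compatible G" "F.splits (fst ` G)" "F'.splits (snd ` G)"
    "v ` {..<m} \<subseteq> fst ` G" "v' ` {..<m} \<subseteq> snd ` G"
proof -
  let ?L = "\<lambda>c k. of_bool (k = c) - of_bool (k = F.base) :: int"
  have "\<forall>c\<in>F.reps. \<exists>x. \<forall>k<m. inc x k = ?L c k" "\<forall>c\<in>F.reps. \<exists>x. \<forall>k<m. inc' x k = ?L c k"
    using F.inc_surj F'.inc_surj F.reps_less F.base_less by blast+
  then obtain s t' where s: "\<And>c k. c \<in> F.reps \<Longrightarrow> k < m \<Longrightarrow> inc (s c) k = ?L c k"
    and t': "\<And>c k. c \<in> F.reps \<Longrightarrow> k < m \<Longrightarrow> inc' (t' c) k = ?L c k"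
    by metis
  define \<delta> where "\<delta> c d = b (s c) (s d) - b' (t' c) (t' d)" for c d
  \<comment> \<open>Only entries with \<open>d < c\<close> are corrected; the remaining ones will
    follow from the symmetrized form. The minus sign in \<open>b_lift_cycle_vec(2)\<close> makes the
    coefficient \<open>\<delta> c d\<close> cancel the discrepancy.\<close>
  define corr where "corr c = (\<Sum>d\<in>{d\<in>F.reps. d < c}. scale (\<delta> c d) (F.cycle_vec d))" for c
  define t where "t c = s c + corr c" for c
  have corr: "inc (corr c) k = 0" if "k < m" for c k
    using that by (simp add: corr_def F.lin F.inc_cycle_vec)
  have t: "inc (t c) k = ?L c k" if "c \<in> F.reps" "k < m" for c k
    using that by (simp add: t_def F.lin corr s)
  have less: "b (t c) (t d) = b' (t' c) (t' d)" if "c \<in> F.reps" "d \<in> F.reps" "d < c" for c d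
  proof -
    have "b (corr c) (s d) = (\<Sum>e\<in>{e\<in>F.reps. e < c}. - (\<delta> c e * of_bool (e = d)))"
      unfolding corr_def F.lin using that
      by (intro sum.cong) (auto simp: F.lin F.b_lift_cycle_vec(2)[OF s])
    also have "\<dots> = - \<delta> c d"
      using that F.finite_reps by (simp only: sum_negf) (simp add: sum_of_bool_pick)
    finally have "b (corr c) (s d) = - \<delta> c d" .
    \<comment> \<open>The sum runs over indices below \<open>d\<close>, so it never meets
      \<open>c\<close>.\<close>
    moreover have "b (s c) (corr d) = 0"
      unfolding corr_def F.lin using that
      by (intro sum.neutral) (auto simp: F.lin F.b_lift_cycle_vec(1)[OF s])
    moreover have "b (corr c) (corr d) = 0"
      unfolding corr_def[of d] F.lin
      by (intro sum.neutral) (auto simp: F.lin F.b_cycle_vec_kernel corr)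
    ultimately show ?thesis by (simp add: t_def F.lin \<delta>_def)
  qed
  have tt: "b (t c) (t d) = b' (t' c) (t' d)" if "c \<in> F.reps" "d \<in> F.reps" for c d
  proof -
    \<comment> \<open>This gives the entries above the diagonal from those below, and for
      \<open>c = d\<close> twice the diagonal entry.\<close>
    have "b (t c) (t d) + b (t d) (t c) = b' (t' c) (t' d) + b' (t' d) (t' c)"
      using that by (intro b_sym_transfer) (simp_all add: t t')
    then show ?thesis using that less[of c d] less[of d c] by (cases c d rule: linorder_cases) auto
  qed
  define G where "G = (\<lambda>a. (v a, v' a)) ` {..<m} \<union> (\<lambda>c. (t c, t' c)) ` F.reps"
  have "compatible G"
    unfolding compatible_def G_def
    by (auto simp: F.inc_v F'.inc_v t t' tt F.b_v F'.b_v F.b_v_left F'.b_v_left F.p_less)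
  moreover have "fst ` G = v ` {..<m} \<union> t ` F.reps" "snd ` G = v' ` {..<m} \<union> t' ` F.reps"
    unfolding G_def image_Un image_image by simp_all
  moreover have "F.splits (v ` {..<m} \<union> t ` F.reps)"
    by (rule F.splits_lifts) (rule t)
  moreover have "F'.splits (v' ` {..<m} \<union> t' ` F.reps)"
    by (rule F'.splits_lifts) (rule t')
  ultimately show thesis using that[of G] by simp
qed

text \<open>Hyperbolic pairs are added on both sides simultaneously until one complement lies in the
  radical. No ranks are compared, hence the disjunction: it is left open which side is exhausted
  first.\<close>

lemma extend_until_spanning:
  assumes "compatible G" "F.splits (fst ` G)" "F'.splits (snd ` G)"
    "v ` {..<m} \<subseteq> fst ` G" "v' ` {..<m} \<subseteq> snd ` G"
  shows "\<exists>G. compatible G \<and> ((\<forall>x. \<exists>y\<in>group_closure (fst ` G). \<forall>z. b (x - y) z = 0) \<or>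
    (\<forall>x. \<exists>y\<in>group_closure (snd ` G). \<forall>z. b' (x - y) z = 0))"
  using assms
proof (induction "card (F.parity ` F.perp (fst ` G))" arbitrary: G rule: less_induct)
  case less
  note G = less.prems
  show ?case
  proof (cases "(\<forall>x\<in>F.perp (fst ` G). \<forall>z. b x z = 0) \<or> (\<forall>x\<in>F'.perp (snd ` G). \<forall>z. b' x z = 0)")
    case True
    have "(\<forall>x. \<exists>y\<in>group_closure (fst ` G). \<forall>z. b (x - y) z = 0) \<or>
      (\<forall>x. \<exists>y\<in>group_closure (snd ` G). \<forall>z. b' (x - y) z = 0)"
      using True G(2,3) unfolding F.splits_def F'.splits_def by blast
    with G(1) show ?thesis by blast
  next
    case False
    then obtain k y k' y' where k: "k \<in> F.perp (fst ` G)" "b k y \<noteq> 0"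
      and k': "k' \<in> F'.perp (snd ` G)" "b' k' y' \<noteq> 0" by blast
    obtain g h where g: "g \<in> F.perp (fst ` G)" "h \<in> F.perp (fst ` G)" "b g h = 1"
      by (rule F.hyperbolic_pair[OF G(2) k])
    obtain g' h' where g': "g' \<in> F'.perp (snd ` G)" "h' \<in> F'.perp (snd ` G)" "b' g' h' = 1"
      by (rule F'.hyperbolic_pair[OF G(3) k'])
    let ?G = "insert (g, g') (insert (h, h') G)"
    note inc = F.perp_inc[OF G(4) g(1)] F.perp_inc[OF G(4) g(2)]
      F'.perp_inc[OF G(5) g'(1)] F'.perp_inc[OF G(5) g'(2)]
    have anti: "b x g = - b g x" "b x h = - b h x" "b' x' g' = - b' g' x'" "b' x' h' = - b' h' x'" for x x'
      by (rule F.anti(2)[OF inc(1)] F.anti(2)[OF inc(2)] F'.anti(2)[OF inc(3)] F'.anti(2)[OF inc(4)];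
          assumption)+
    have self: "b g g = 0" "b h h = 0" "b' g' g' = 0" "b' h' h' = 0"
      using anti(1)[of g] anti(2)[of h] anti(3)[of g'] anti(4)[of h'] by simp_all
    have hg: "b h g = -1" "b' h' g' = -1" using anti(1)[of h] anti(3)[of h'] g(3) g'(3) by simp_all
    have perp: "b g x = 0" "b h x = 0" "b' g' x' = 0" "b' h' x' = 0" if "(x, x') \<in> G" for x x'
      using g(1,2) g'(1,2) that by (force simp: F.perp_def F'.perp_def)+
    have perp': "b x g = 0" "b x h = 0" "b' x' g' = 0" "b' x' h' = 0" if "(x, x') \<in> G" for x x'
      using perp[OF that] anti(1)[of x] anti(2)[of x] anti(3)[of x'] anti(4)[of x'] by simp_all
    have "compatible ?G"
      using G(1) inc self hg g(3) g'(3) perp perp' unfolding compatible_def by auto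
    moreover have "F.splits (fst ` ?G)" "F'.splits (snd ` ?G)"
      using F.splits_insert_hyperbolic[OF G(2,4) g] F'.splits_insert_hyperbolic[OF G(3,5) g'] by simp_all
    moreover have "v ` {..<m} \<subseteq> fst ` ?G" "v' ` {..<m} \<subseteq> snd ` ?G" using G(4,5) by auto
    moreover have "card (F.parity ` F.perp (fst ` ?G)) < card (F.parity ` F.perp (fst ` G))"
      using F.parity_perp_decreases[OF g(1,3)] by simp
    ultimately show ?thesis using less.hyps by blast
  qed
qed

lemma isometry:
  "(\<exists>\<phi>. \<forall>i j. b' (\<phi> i) (\<phi> j) = b (e i) (e j) \<and> (\<forall>k<m. inc' (\<phi> i) k = inc (e i) k)) \<or>
   (\<exists>\<phi>. \<forall>i j. b (\<phi> i) (\<phi> j) = b' (e' i) (e' j) \<and> (\<forall>k<m. inc (\<phi> i) k = inc' (e' i) k))"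
proof -
  obtain G where G: "compatible G" and
    alt: "(\<forall>x. \<exists>y\<in>group_closure (fst ` G). \<forall>z. b (x - y) z = 0) \<or>
      (\<forall>x. \<exists>y\<in>group_closure (snd ` G). \<forall>z. b' (x - y) z = 0)"
    using initial_pairs extend_until_spanning by metis
  note comp = compatible_group_closure[OF G, unfolded compatible_def]
  from alt show ?thesis
  proof
    assume "\<forall>x. \<exists>y\<in>group_closure (fst ` G). \<forall>z. b (x - y) z = 0"
    then have "\<forall>i. \<exists>y y'. (y, y') \<in> group_closure G \<and> (\<forall>z. b (e i - y) z = 0)"
      using group_closure_fst_lift by blast
    then obtain f \<phi> where f: "\<And>i. (f i, \<phi> i) \<in> group_closure G"
      "\<And>i z. b (e i - f i) z = 0" by metis
    \<comment> \<open>A vector of the left radical pairs to 0 with the \<open>v k\<close>, so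
      \<open>inc\<close> kills it; by \<open>anti\<close> it then lies in the right radical too.
      Thus \<open>f i\<close> can replace \<open>e i\<close> in both arguments.\<close>
    have inc: "inc (e i - f i) k = 0" if "k < m" for i k
      using F.b_v[OF that, of "e i - f i"] f(2) by simp
    have "b z (e i - f i) = 0" for z i
      using F.anti(2)[OF inc] f(2) by simp
    then have "b (f i) (f j) = b (e i) (e j)" for i j
      using f(2) by (metis F.bl.diff F.br.diff eq_iff_diff_eq_0)
    then have "b' (\<phi> i) (\<phi> j) = b (e i) (e j)" for i j
      using comp f(1)[of i] f(1)[of j] by fastforce
    moreover have "inc' (\<phi> i) k = inc (e i) k" if "k < m" for i k
      using comp f(1)[of i] inc[OF that, of i] that by (fastforce simp: F.lin)
    ultimately show ?thesis by blast
  next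
    assume "\<forall>x. \<exists>y\<in>group_closure (snd ` G). \<forall>z. b' (x - y) z = 0"
    then have "\<forall>i. \<exists>y y'. (y, y') \<in> group_closure G \<and> (\<forall>z. b' (e' i - y') z = 0)"
      using group_closure_snd_lift by blast
    then obtain \<phi> f where f: "\<And>i. (\<phi> i, f i) \<in> group_closure G"
      "\<And>i z. b' (e' i - f i) z = 0" by metis
    have inc: "inc' (e' i - f i) k = 0" if "k < m" for i k
      using F'.b_v[OF that, of "e' i - f i"] f(2) by simp
    have "b' z (e' i - f i) = 0" for z i
      using F'.anti(2)[OF inc] f(2) by simp
    then have "b' (f i) (f j) = b' (e' i) (e' j)" for i j
      using f(2) by (metis F'.bl.diff F'.br.diff eq_iff_diff_eq_0)
    then have "b (\<phi> i) (\<phi> j) = b' (e' i) (e' j)" for i j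
      using comp f(1)[of i] f(1)[of j] by fastforce
    moreover have "inc (\<phi> i) k = inc' (e' i) k" if "k < m" for i k
      using comp f(1)[of i] inc[OF that, of i] that by (fastforce simp: F'.lin)
    ultimately show ?thesis by blast
  qed
qed

end

section \<open>Quivers as incidence forms\<close>

lemma index_mult_mat_sum:
  assumes "A \<in> carrier_mat a n" "B \<in> carrier_mat n c" "i < a" "j < c"
  shows "(A * B) $$ (i, j) = (\<Sum>k<n. A $$ (i, k) * B $$ (k, j))"
  using assms by (auto simp: scalar_prod_def atLeast0LessThan intro!: sum.cong)

text \<open>Integer vectors are functions on all naturals, since a type cannot depend on
  \<open>n\<close>. The form and the map of a matrix read only the coordinates within its
  dimensions; the others lie in the radical.\<close>

definition zscale :: "int \<Rightarrow> (nat \<Rightarrow> int) \<Rightarrow> nat \<Rightarrow> int" where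
  "zscale r x = (\<lambda>i. r * x i)"

definition zunit :: "nat \<Rightarrow> nat \<Rightarrow> int" where
  "zunit i = (\<lambda>j. of_bool (j = i))"

definition mat_form :: "int mat \<Rightarrow> (nat \<Rightarrow> int) \<Rightarrow> (nat \<Rightarrow> int) \<Rightarrow> int" where
  "mat_form M x y = (\<Sum>i<dim_row M. \<Sum>j<dim_col M. x i * M $$ (i, j) * y j)"

definition mat_map :: "int mat \<Rightarrow> (nat \<Rightarrow> int) \<Rightarrow> nat \<Rightarrow> int" where
  "mat_map M x k = (\<Sum>i<dim_col M. M $$ (k, i) * x i)"

lemma mat_form_zunit:
  assumes "j < dim_col M"
  shows "mat_form M x (zunit j) = (\<Sum>i<dim_row M. x i * M $$ (i, j))"
  using assms by (simp add: mat_form_def zunit_def sum_of_bool_pick)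

lemma mat_form_zunit_zunit:
  assumes "i < dim_row M" "j < dim_col M"
  shows "mat_form M (zunit i) (zunit j) = M $$ (i, j)"
proof -
  have "mat_form M (zunit i) (zunit j) = (\<Sum>k<dim_row M. M $$ (k, j) * of_bool (k = i))"
    unfolding mat_form_zunit[OF assms(2)] by (simp add: zunit_def mult.commute)
  then show ?thesis using assms by (simp only: sum_of_bool_pick finite_lessThan) simp
qed

lemma mat_map_zunit: "i < dim_col M \<Longrightarrow> mat_map M (zunit i) k = M $$ (k, i)"
  by (simp add: mat_map_def zunit_def sum_of_bool_pick)

lemma coxeter_laplacian_index:
  assumes Q: "quiver m n Q" and lf: "loopfree_digraph Q" and kx: "k < m" "x < m"
  defines "W \<equiv> incidence_mat Q * mat_inv (upper_gram_mat Q)"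
  shows "coxeter_laplacian Q $$ (k, x) =
    of_bool (k = x) - (\<Sum>i<n. W $$ (k, i) * incidence_mat Q $$ (x, i))"
proof -
  note E = incidence_mat_carrier[OF Q]
  have W: "W \<in> carrier_mat m n" using E mat_inv_upper_gram_mat[OF Q lf] by (auto simp: W_def)
  have "(W * transpose_mat (incidence_mat Q)) $$ (k, x)
      = (\<Sum>i<n. W $$ (k, i) * incidence_mat Q $$ (x, i))"
    using W E kx by (subst index_mult_mat_sum[OF W]) auto
  then show ?thesis
    using Q E W kx by (simp add: coxeter_laplacian_def W_def[symmetric] quiver_def)
qed

lemma quiver_ends:
  assumes "quiver m n Q" "loopfree_digraph Q" "j < n"
  shows "tail Q j < m" "head Q j < m" "tail Q j \<noteq> head Q j"
proof -
  interpret loopfree_digraph Q by fact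
  show "tail Q j < m" "head Q j < m" "tail Q j \<noteq> head Q j"
    using assms no_loops[of j] tail_in_verts[of j] head_in_verts[of j] by (auto simp: quiver_def)
qed

text \<open>
  The partial sums of the Coxeter--Laplacian are the products of the transpositions
  \<open>(s(i) t(i))\<close>.
\<close>

lemma coxeter_laplacian_permutation:
  assumes Q: "quiver m n Q" and lf: "loopfree_digraph Q"
  shows "\<exists>p. p permutes {..<m} \<and>
    (\<forall>k<m. \<forall>x<m. coxeter_laplacian Q $$ (k, x) = of_bool (k = p x))"
proof -
  define E where "E = incidence_mat Q"
  define U where "U = upper_gram_mat Q"
  define W where "W = E * mat_inv U"
  note U = upper_gram_mat[OF Q lf, folded U_def]
  note Ui = mat_inv_upper_gram_mat[OF Q lf, folded U_def]
  note ends = quiver_ends[OF Q lf]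
  have E: "E \<in> carrier_mat m n" using incidence_mat_carrier[OF Q] by (simp add: E_def)
  have W: "W \<in> carrier_mat m n" using E Ui by (auto simp: W_def)
  have Ei: "E $$ (k, j) = of_bool (k = tail Q j) - of_bool (k = head Q j)" if "k < m" "j < n" for k j
    using incidence_mat_index[OF Q that] by (simp add: E_def)
  have WU: "W * U = E" using E U(1) Ui by (simp add: W_def assoc_mult_mat[OF E Ui(1) U(1)])
  \<comment> \<open>Column \<open>j\<close> of \<open>W * U = E\<close>, solved for column
    \<open>j\<close> of \<open>W\<close>: \<open>U\<close> has ones on the diagonal and Gram entries
    above it.\<close>
  have Wrec: "W $$ (k, j) = E $$ (k, j) -
      (\<Sum>i<j. W $$ (k, i) * (E $$ (tail Q j, i) - E $$ (head Q j, i)))" if "k < m" "j < n" for k j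
  proof -
    have "E $$ (k, j) = (\<Sum>i<n. W $$ (k, i) * U $$ (i, j))"
      using index_mult_mat_sum[OF W U(1) that] WU by simp
    also have "\<dots> = (\<Sum>i<Suc j. W $$ (k, i) * U $$ (i, j))"
      using that U(1) by (intro sum.mono_neutral_right) (auto simp: upper_triangularD[OF U(2)])
    also have "\<dots> = (\<Sum>i<j. W $$ (k, i) * U $$ (i, j)) + W $$ (k, j)"
      using U(4) that by simp
    also have "(\<Sum>i<j. W $$ (k, i) * U $$ (i, j))
        = (\<Sum>i<j. W $$ (k, i) * (E $$ (tail Q j, i) - E $$ (head Q j, i)))"
      using that U(5) gram_mat_index[OF Q] by (intro sum.cong) (auto simp: E_def)
    finally show ?thesis by simp
  qed
  have "\<exists>p. p permutes {..<m} \<and>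
      (\<forall>k<m. \<forall>x<m. of_bool (k = x) - (\<Sum>i<j. W $$ (k, i) * E $$ (x, i)) = of_bool (k = p x))"
    if "j \<le> n" for j
    using that
  proof (induction j)
    case 0
    show ?case by (intro exI[of _ id] conjI permutes_id) simp
  next
    case (Suc j)
    then obtain p where p: "p permutes {..<m}" and
      pe: "\<And>k x. k < m \<Longrightarrow> x < m \<Longrightarrow>
        of_bool (k = x) - (\<Sum>i<j. W $$ (k, i) * E $$ (x, i)) = of_bool (k = p x)"
      by auto
    let ?s = "tail Q j" and ?t = "head Q j"
    have j: "j < n" using Suc.prems by simp
    note st = ends[OF j]
    \<comment> \<open>The sum in \<open>Wrec\<close> is the difference of two partial sums, at the
      rows of the tail and the head, which the induction hypothesis evaluates.\<close>
    have Wj: "W $$ (k, j) = of_bool (k = p ?s) - of_bool (k = p ?t)" if "k < m" for k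
      using pe[OF that st(1)] pe[OF that st(2)]
      by (simp add: Wrec[OF that j] Ei[OF that j] right_diff_distrib sum_subtractf)
    let ?q = "p \<circ> Transposition.transpose ?s ?t"
    have q: "?q permutes {..<m}"
      using st by (intro permutes_compose[OF _ p] permutes_swap_id) auto
    have "of_bool (k = x) - (\<Sum>i<Suc j. W $$ (k, i) * E $$ (x, i)) = of_bool (k = ?q x)"
      if "k < m" "x < m" for k x
    proof -
      have "of_bool (k = x) - (\<Sum>i<Suc j. W $$ (k, i) * E $$ (x, i))
          = of_bool (k = p x) - W $$ (k, j) * E $$ (x, j)"
        using pe[OF that] by simp
      also have "\<dots> = of_bool (k = ?q x)"
        using st(3) by (auto simp: Wj[OF that(1)] Ei[OF that(2) j] Transposition.transpose_def)
      finally show ?thesis .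
    qed
    with q show ?case by blast
  qed
  then show ?thesis
    using coxeter_laplacian_index[OF Q lf] by (fastforce simp: W_def E_def U_def)
qed

text \<open>Along a walk from \<open>c\<close> to \<open>a\<close> in the underlying graph, the
  signed columns of the arrows telescope.\<close>

lemma connected_incidence_surj:
  assumes Q: "quiver m n Q" and lf: "loopfree_digraph Q" and conn: "Digraph_Component.connected Q"
    and ac: "a < m" "c < m"
  shows "\<exists>x. \<forall>k<m. mat_map (incidence_mat Q) x k = of_bool (k = a) - of_bool (k = c)"
proof -
  note E = incidence_mat_carrier[OF Q]
  have "c \<rightarrow>\<^sup>*\<^bsub>with_proj (mk_symmetric Q)\<^esub> a"
    using conn ac Q by (auto simp: Digraph_Component.connected_def strongly_connected_def quiver_def)
  then have "(c, a) \<in> rtrancl_on (verts Q) (parcs (mk_symmetric Q))"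
    by (simp add: reachable_def)
  then show ?thesis
  proof (induction rule: rtrancl_on_induct)
    case base
    show ?case by (intro exI[of _ "\<lambda>_. 0"]) (simp add: mat_map_def)
  next
    case (step y z)
    then obtain x where x: "\<And>k. k < m \<Longrightarrow>
      mat_map (incidence_mat Q) x k = of_bool (k = y) - of_bool (k = c)" by blast
    obtain j where j: "j < n" and yz: "(y, z) = (tail Q j, head Q j) \<or> (y, z) = (head Q j, tail Q j)"
      using step(2) Q by (auto simp: parcs_mk_symmetric quiver_def)
    have upd: "mat_map (incidence_mat Q) (\<lambda>i. x i + r * zunit j i) k =
      mat_map (incidence_mat Q) x k + r * incidence_mat Q $$ (k, j)" for r k
    proof -
      have "mat_map (incidence_mat Q) (\<lambda>i. x i + r * zunit j i) k =
        mat_map (incidence_mat Q) x k + r * mat_map (incidence_mat Q) (zunit j) k"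
        by (simp add: mat_map_def sum_distrib_left sum.distrib[symmetric] algebra_simps)
      then show ?thesis using mat_map_zunit[of j "incidence_mat Q" k] E j by simp
    qed
    have ind: "incidence_mat Q $$ (k, j) = of_bool (k = tail Q j) - of_bool (k = head Q j)" if "k < m" for k
      by (rule incidence_mat_index[OF Q that j])
    \<comment> \<open>A column is tail minus head, so an arrow traversed forwards counts with sign
      -1.\<close>
    from yz show ?case
    proof
      assume "(y, z) = (tail Q j, head Q j)"
      then show ?thesis
        by (intro exI[of _ "\<lambda>i. x i + (-1) * zunit j i"]) (simp only: upd, simp add: x ind)
    next
      assume "(y, z) = (head Q j, tail Q j)"
      then show ?thesis
        by (intro exI[of _ "\<lambda>i. x i + 1 * zunit j i"]) (simp only: upd, simp add: x ind)
    qed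
  qed
qed

definition vertex_vec :: "(nat, nat) pre_digraph \<Rightarrow> nat \<Rightarrow> nat \<Rightarrow> int" where
  "vertex_vec Q a = mat_map (mat_inv (upper_gram_mat Q)) (\<lambda>j. incidence_mat Q $$ (a, j))"

lemma incidence_form_quiver:
  assumes Q: "quiver m n Q" and lf: "loopfree_digraph Q" and conn: "Digraph_Component.connected Q"
    and p: "p permutes {..<m}"
    and cox: "\<And>k x. k < m \<Longrightarrow> x < m \<Longrightarrow> coxeter_laplacian Q $$ (k, x) = of_bool (k = p x)"
  shows "incidence_form zscale m n p zunit (mat_form (upper_gram_mat Q))
    (mat_map (incidence_mat Q)) (vertex_vec Q)"
proof -
  define E where "E = incidence_mat Q"
  define U where "U = upper_gram_mat Q"
  define V where "V = mat_inv U"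
  note U = upper_gram_mat[OF Q lf, folded U_def]
  note V = mat_inv_upper_gram_mat[OF Q lf, folded U_def, folded V_def]
  have E: "E \<in> carrier_mat m n" using incidence_mat_carrier[OF Q] by (simp add: E_def)
  have dims: "dim_row E = m" "dim_col E = n" "dim_row U = n" "dim_col U = n" "dim_row V = n" "dim_col V = n"
    using E U(1) V(1) by auto
  have vv: "vertex_vec Q a i = (\<Sum>j<n. V $$ (i, j) * E $$ (a, j))" for a i
    using dims by (simp add: vertex_vec_def mat_map_def V_def U_def E_def)
  have UV: "(\<Sum>j<n. U $$ (i, j) * V $$ (j, l)) = of_bool (i = l)"
    "(\<Sum>j<n. V $$ (i, j) * U $$ (j, l)) = of_bool (i = l)" if "i < n" "l < n" for i l
    unfolding index_mult_mat_sum[OF U(1) V(1) that, symmetric]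
      index_mult_mat_sum[OF V(1) U(1) that, symmetric] V(2,3) using that by simp_all
  have UU: "U $$ (i, j) + U $$ (j, i) = (\<Sum>k<m. E $$ (k, i) * E $$ (k, j))" if "i < n" "j < n" for i j
  proof -
    have "U $$ (i, j) + U $$ (j, i) = gram_mat Q $$ (i, j)"
      using U(1) that by (simp flip: U(3))
    also have "\<dots> = (\<Sum>k<m. E $$ (k, i) * E $$ (k, j))"
      unfolding gram_mat_def E_def[symmetric] using E that
      by (subst index_mult_mat_sum[of _ n m _ n]) auto
    finally show ?thesis .
  qed
  show ?thesis
    unfolding U_def[symmetric] E_def[symmetric]
  proof
    show "0 < m"
      using conn Q by (auto simp: Digraph_Component.connected_def strongly_connected_def quiver_def)
    show "p permutes {..<m}" by fact
    show "zscale a (x + y) = zscale a x + zscale a y" "zscale (a + b) x = zscale a x + zscale b x"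
      "zscale a (zscale b x) = zscale (a * b) x" "zscale 1 x = x" for a b x y
      by (simp_all add: zscale_def fun_eq_iff algebra_simps)
    show "mat_form U (x + y) z = mat_form U x z + mat_form U y z"
      "mat_form U z (x + y) = mat_form U z x + mat_form U z y" for x y z
      by (simp_all add: mat_form_def algebra_simps sum.distrib)
    show "mat_form U (zscale r x) y = r * mat_form U x y"
      "mat_form U x (zscale r y) = r * mat_form U x y" for r x y
      by (simp_all add: mat_form_def zscale_def sum_distrib_left mult_ac)
    show "mat_map E (x + y) k = mat_map E x k + mat_map E y k"
      "mat_map E (zscale r x) k = r * mat_map E x k" for r x y k
      by (simp_all add: mat_map_def zscale_def algebra_simps sum.distrib sum_distrib_left)
    show "\<exists>f. \<forall>x. mat_form U x y = (\<Sum>i<n. f i * mat_form U x (zunit i))" for y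
    proof (intro exI[of _ y] allI)
      fix x
      have "mat_form U x y = (\<Sum>j<n. \<Sum>i<n. x i * U $$ (i, j) * y j)"
        unfolding mat_form_def dims by (rule sum.swap)
      also have "\<dots> = (\<Sum>j<n. y j * mat_form U x (zunit j))"
        by (intro sum.cong) (simp_all add: mat_form_zunit dims sum_distrib_left mult_ac)
      finally show "mat_form U x y = (\<Sum>i<n. y i * mat_form U x (zunit i))" .
    qed
    show "\<exists>x. \<forall>i<n. mat_form U x (zunit i) = f i" for f
    \<comment> \<open>The row vector \<open>f\<close> times the inverse \<open>V\<close> of
      \<open>U\<close>.\<close>
    proof (intro exI[of _ "\<lambda>i. \<Sum>j<n. f j * V $$ (j, i)"] allI impI)
      fix l assume l: "l < n"
      have "mat_form U (\<lambda>i. \<Sum>j<n. f j * V $$ (j, i)) (zunit l)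
          = (\<Sum>i<n. \<Sum>j<n. f j * (V $$ (j, i) * U $$ (i, l)))"
        using l by (simp add: mat_form_zunit dims sum_distrib_right mult.assoc)
      also have "\<dots> = (\<Sum>j<n. \<Sum>i<n. f j * (V $$ (j, i) * U $$ (i, l)))"
        by (rule sum.swap)
      also have "\<dots> = (\<Sum>j<n. f j * of_bool (j = l))"
        using l by (intro sum.cong) (simp_all add: sum_distrib_left[symmetric] UV)
      finally show "mat_form U (\<lambda>i. \<Sum>j<n. f j * V $$ (j, i)) (zunit l) = f l"
        using l by (simp only: sum_of_bool_pick finite_lessThan) simp
    qed
    show "mat_form U x y + mat_form U y x = (\<Sum>k<m. mat_map E x k * mat_map E y k)" for x y
    proof -
      have "mat_form U y x = (\<Sum>i<n. \<Sum>j<n. y j * U $$ (j, i) * x i)"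
        unfolding mat_form_def dims by (rule sum.swap)
      then have "mat_form U x y + mat_form U y x
          = (\<Sum>i<n. \<Sum>j<n. x i * (U $$ (i, j) + U $$ (j, i)) * y j)"
        by (simp add: mat_form_def dims sum.distrib[symmetric] algebra_simps)
      also have "\<dots> = (\<Sum>i<n. \<Sum>j<n. \<Sum>k<m. (E $$ (k, i) * x i) * (E $$ (k, j) * y j))"
        by (intro sum.cong) (simp_all add: UU sum_distrib_left sum_distrib_right mult_ac)
      also have "\<dots> = (\<Sum>i<n. \<Sum>k<m. \<Sum>j<n. (E $$ (k, i) * x i) * (E $$ (k, j) * y j))"
        by (intro sum.cong refl sum.swap)
      also have "\<dots> = (\<Sum>k<m. \<Sum>i<n. \<Sum>j<n. (E $$ (k, i) * x i) * (E $$ (k, j) * y j))"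
        by (rule sum.swap)
      also have "\<dots> = (\<Sum>k<m. mat_map E x k * mat_map E y k)"
        by (simp add: mat_map_def dims sum_product)
      finally show ?thesis .
    qed
    show "(\<Sum>k<m. mat_map E x k) = 0" for x
    proof -
      have "(\<Sum>k<m. E $$ (k, i)) = 0" if "i < n" for i
      proof -
        have "(\<Sum>k<m. E $$ (k, i)) = (\<Sum>k<m. of_bool (k = tail Q i) - of_bool (k = head Q i))"
          using incidence_mat_index[OF Q _ that] by (intro sum.cong) (simp_all add: E_def)
        then show ?thesis using quiver_ends[OF Q lf that] by (simp only: sum_subtractf sum_of_bool_pick finite_lessThan) simp
      qed
      then have "(\<Sum>i<n. (\<Sum>k<m. E $$ (k, i)) * x i) = 0" by simp
      then show ?thesis
        unfolding mat_map_def dims by (subst sum.swap) (simp add: sum_distrib_right)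
    qed
    show "\<exists>x. \<forall>k<m. mat_map E x k = of_bool (k = a) - of_bool (k = c)" if "a < m" "c < m" for a c
      using connected_incidence_surj[OF Q lf conn that] by (simp add: E_def)
    show "mat_form U x (vertex_vec Q a) = mat_map E x a" for x a
    proof -
      have "(\<Sum>j<n. U $$ (i, j) * vertex_vec Q a j) = E $$ (a, i)" if "i < n" for i
      proof -
        have "(\<Sum>j<n. U $$ (i, j) * vertex_vec Q a j)
            = (\<Sum>j<n. \<Sum>l<n. E $$ (a, l) * (U $$ (i, j) * V $$ (j, l)))"
          by (simp add: vv sum_distrib_left mult_ac)
        also have "\<dots> = (\<Sum>l<n. \<Sum>j<n. E $$ (a, l) * (U $$ (i, j) * V $$ (j, l)))"
          by (rule sum.swap)
        also have "\<dots> = (\<Sum>l<n. E $$ (a, l) * of_bool (i = l))"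
          using that by (intro sum.cong) (simp_all add: sum_distrib_left[symmetric] UV)
        finally show ?thesis using that by (simp only: sum_of_bool_pick finite_lessThan) simp
      qed
      then have "(\<Sum>i<n. x i * (\<Sum>j<n. U $$ (i, j) * vertex_vec Q a j)) = (\<Sum>i<n. x i * E $$ (a, i))"
        by simp
      then show ?thesis
        by (simp add: mat_form_def mat_map_def dims sum_distrib_left mult_ac)
    qed
    \<comment> \<open>\<open>E * V * transpose_mat E\<close> is the identity minus the
      Coxeter-Laplacian, which is the permutation matrix of \<open>p\<close>.\<close>
    show "mat_map E (vertex_vec Q a) k = of_bool (k = a) - of_bool (k = p a)" if "a < m" "k < m" for a k
    proof -
      have "mat_map E (vertex_vec Q a) k = (\<Sum>i<n. \<Sum>j<n. E $$ (k, i) * V $$ (i, j) * E $$ (a, j))"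
        by (simp add: mat_map_def dims vv sum_distrib_left mult_ac)
      also have "\<dots> = (\<Sum>j<n. \<Sum>i<n. E $$ (k, i) * V $$ (i, j) * E $$ (a, j))"
        by (rule sum.swap)
      also have "\<dots> = (\<Sum>j<n. (E * V) $$ (k, j) * E $$ (a, j))"
        using that by (intro sum.cong) (simp_all only: index_mult_mat_sum[OF E V(1)] lessThan_iff sum_distrib_right)
      finally show ?thesis
        using coxeter_laplacian_index[OF Q lf that(2,1)] cox[OF that(2,1)] by (simp add: E_def V_def U_def)
    qed
  qed
qed

section \<open>From isometries to congruences of matrices\<close>

lemma congruence_of_isometry:
  assumes "U \<in> carrier_mat n n" "U' \<in> carrier_mat n n" "E \<in> carrier_mat m n" "E' \<in> carrier_mat m n"
    and form: "\<And>i j. mat_form U (\<phi> i) (\<phi> j) = mat_form U' (zunit i) (zunit j)"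
    and map: "\<And>i k. k < m \<Longrightarrow> mat_map E (\<phi> i) k = mat_map E' (zunit i) k"
  shows "\<exists>B\<in>carrier_mat n n. E * B = E' \<and> U' = transpose_mat B * U * B"
proof
  let ?B = "mat n n (\<lambda>(i, j). \<phi> j i)"
  have B: "?B \<in> carrier_mat n n" "transpose_mat ?B \<in> carrier_mat n n" by simp_all
  have BU: "transpose_mat ?B * U \<in> carrier_mat n n" by (rule mult_carrier_mat[OF B(2) assms(1)])
  show "?B \<in> carrier_mat n n" by simp
  have "E * ?B = E'"
  proof (rule eq_matI)
    fix k j assume "k < dim_row E'" "j < dim_col E'"
    then have kj: "k < m" "j < n" using assms by auto
    have "(E * ?B) $$ (k, j) = mat_map E (\<phi> j) k"
      using kj assms(3) by (subst index_mult_mat_sum[OF assms(3) B(1)]) (simp_all add: mat_map_def)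
    also have "\<dots> = E' $$ (k, j)" using map[OF kj(1), of j] mat_map_zunit[of j E' k] kj assms by simp
    finally show "(E * ?B) $$ (k, j) = E' $$ (k, j)" .
  qed (use assms in auto)
  moreover have "U' = transpose_mat ?B * U * ?B"
  proof (rule eq_matI)
    fix i j assume "i < dim_row (transpose_mat ?B * U * ?B)" "j < dim_col (transpose_mat ?B * U * ?B)"
    then have ij: "i < n" "j < n" by auto
    have "(transpose_mat ?B * U * ?B) $$ (i, j) = (\<Sum>l<n. \<Sum>k<n. \<phi> i k * U $$ (k, l) * \<phi> j l)"
      using ij by (simp add: index_mult_mat_sum[OF BU B(1)] index_mult_mat_sum[OF B(2) assms(1)]
          sum_distrib_right del: index_mult_mat)
    also have "\<dots> = (\<Sum>k<n. \<Sum>l<n. \<phi> i k * U $$ (k, l) * \<phi> j l)"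
      by (rule sum.swap)
    also have "\<dots> = mat_form U (\<phi> i) (\<phi> j)" using assms(1) by (simp add: mat_form_def)
    also have "\<dots> = U' $$ (i, j)" using form[of i j] mat_form_zunit_zunit[of i U' j] ij assms(2) by simp
    finally show "U' $$ (i, j) = (transpose_mat ?B * U * ?B) $$ (i, j)" by simp
  qed (use assms in auto)
  ultimately show "E * ?B = E' \<and> U' = transpose_mat ?B * U * ?B" ..
qed

text \<open>\<open>det B\<close> divides the unit \<open>det U'\<close>, so it is 1 or -1 and is its
  own inverse; the adjugate times \<open>det B\<close> is then the inverse of
  \<open>B\<close>.\<close>

lemma congruence_inverse:
  fixes U U' V' B :: "int mat"
  assumes U: "U \<in> carrier_mat n n" and B: "B \<in> carrier_mat n n"
    and V': "V' \<in> carrier_mat n n" "U' * V' = 1\<^sub>m n" and U': "U' = transpose_mat B * U * B"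
  obtains C where "C \<in> carrier_mat n n" "B * C = 1\<^sub>m n" "C * B = 1\<^sub>m n"
proof -
  have BU: "transpose_mat B * U \<in> carrier_mat n n" using U B by simp
  have "U' \<in> carrier_mat n n" using U' BU B by simp
  then have "det U' * det V' = 1" using det_mult[of U' n V'] V' by simp
  moreover have "det U' = det B * det U * det B"
    unfolding U' det_mult[OF BU B] using U B by (simp add: det_mult[of _ n U] det_transpose)
  ultimately have "det B dvd 1" by (metis dvd_mult2 dvd_triv_right)
  then have d: "det B * det B = 1" by (auto simp: zdvd1_eq abs_if split: if_splits)
  let ?C = "det B \<cdot>\<^sub>m adj_mat B"
  note adj = adj_mat[OF B]
  have "det B \<cdot>\<^sub>m (det B \<cdot>\<^sub>m 1\<^sub>m n) = 1\<^sub>m n"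
    by (rule eq_matI) (auto simp: d)
  then have "B * ?C = 1\<^sub>m n" "?C * B = 1\<^sub>m n"
    using adj by (simp_all add: mult_smult_distrib[OF B adj(1)] mult_smult_assoc_mat[OF adj(1) B])
  moreover have "?C \<in> carrier_mat n n" using adj by simp
  ultimately show thesis using that by blast
qed

text \<open>Equal Laplacians give both forms the same permutation, so \<open>isometry\<close>
  applies. If it yields a matrix in the opposite direction, that matrix is inverted.\<close>

lemma coxeter_laplacian_eq_imp_congruence:
  assumes Q: "quiver m n Q" "loopfree_digraph Q" "Digraph_Component.connected Q"
    and Qt: "quiver m n Qt" "loopfree_digraph Qt" "Digraph_Component.connected Qt"
    and eq: "coxeter_laplacian Q = coxeter_laplacian Qt"
  shows "\<exists>B\<in>carrier_mat n n. incidence_mat Q * B = incidence_mat Qt \<and>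
    upper_gram_mat Qt = transpose_mat B * upper_gram_mat Q * B"
proof -
  let ?E = "incidence_mat Q" and ?E' = "incidence_mat Qt"
  let ?U = "upper_gram_mat Q" and ?U' = "upper_gram_mat Qt"
  note E = incidence_mat_carrier[OF Q(1)] and E' = incidence_mat_carrier[OF Qt(1)]
  note U = upper_gram_mat(1)[OF Q(1,2)] and U' = upper_gram_mat(1)[OF Qt(1,2)]
  note V = mat_inv_upper_gram_mat[OF Q(1,2)]
  obtain p where p: "p permutes {..<m}"
    "\<And>k x. k < m \<Longrightarrow> x < m \<Longrightarrow> coxeter_laplacian Q $$ (k, x) = of_bool (k = p x)"
    using coxeter_laplacian_permutation[OF Q(1,2)] by blast
  interpret incidence_form_pair zscale zscale m n p
    zunit "mat_form ?U" "mat_map ?E" "vertex_vec Q"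
    zunit "mat_form ?U'" "mat_map ?E'" "vertex_vec Qt"
    using incidence_form_quiver[OF Q p] incidence_form_quiver[OF Qt p[unfolded eq]]
    by (simp add: incidence_form_pair_def)
  from isometry show ?thesis
  proof
    assume "\<exists>\<phi>. \<forall>i j. mat_form ?U (\<phi> i) (\<phi> j) = mat_form ?U' (zunit i) (zunit j) \<and>
      (\<forall>k<m. mat_map ?E (\<phi> i) k = mat_map ?E' (zunit i) k)"
    then obtain \<phi> where "\<And>i j. mat_form ?U (\<phi> i) (\<phi> j) = mat_form ?U' (zunit i) (zunit j)"
      "\<And>i k. k < m \<Longrightarrow> mat_map ?E (\<phi> i) k = mat_map ?E' (zunit i) k" by blast
    then show ?thesis by (rule congruence_of_isometry[OF U U' E E'])
  next
    assume "\<exists>\<phi>. \<forall>i j. mat_form ?U' (\<phi> i) (\<phi> j) = mat_form ?U (zunit i) (zunit j) \<and>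
      (\<forall>k<m. mat_map ?E' (\<phi> i) k = mat_map ?E (zunit i) k)"
    then obtain \<phi> where "\<And>i j. mat_form ?U' (\<phi> i) (\<phi> j) = mat_form ?U (zunit i) (zunit j)"
      "\<And>i k. k < m \<Longrightarrow> mat_map ?E' (\<phi> i) k = mat_map ?E (zunit i) k" by blast
    then have "\<exists>B\<in>carrier_mat n n. ?E' * B = ?E \<and> ?U = transpose_mat B * ?U' * B"
      by (rule congruence_of_isometry[OF U' U E' E])
    then obtain B where B: "B \<in> carrier_mat n n" "?E' * B = ?E" "?U = transpose_mat B * ?U' * B"
      by blast
    obtain C where C: "C \<in> carrier_mat n n" "B * C = 1\<^sub>m n" "C * B = 1\<^sub>m n"
      by (rule congruence_inverse[OF U' B(1) V(1,2) B(3)])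
    have T: "transpose_mat B \<in> carrier_mat n n" "transpose_mat C \<in> carrier_mat n n" using B C by auto
    have "?E * C = ?E' * (B * C)" using assoc_mult_mat[OF E' B(1) C(1)] B(2) by simp
    then have 1: "?E * C = ?E'" using C(2) E' by simp
    have "transpose_mat C * transpose_mat B = 1\<^sub>m n"
      using transpose_mult[OF B(1) C(1)] C(2) by simp
    then have "transpose_mat C * (transpose_mat B * (?U' * (B * C))) = ?U'"
      using assoc_mult_mat[OF T(2,1) U'] C(2) U' by simp
    moreover have "transpose_mat C * ?U * C = transpose_mat C * (transpose_mat B * (?U' * (B * C)))"
    proof -
      have "?U * C = transpose_mat B * (?U' * (B * C))"
        unfolding B(3) using T U' B(1) C(1)
        by (simp add: assoc_mult_mat[of _ n n _ n _ n])
      then show ?thesis using assoc_mult_mat[OF T(2) U C(1)] by simp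
    qed
    ultimately show ?thesis using 1 C(1) by metis
  qed
qed

section \<open>Equivalence of the three conditions\<close>

theorem theorem4p1:
  fixes m n :: nat and Q Qt :: "(nat, nat) pre_digraph"
  assumes "quiver m n Q" and "loopfree_digraph Q" and "Digraph_Component.connected Q"
    and "quiver m n Qt" and "loopfree_digraph Qt" and "Digraph_Component.connected Qt"
  shows "(coxeter_laplacian Q = coxeter_laplacian Qt \<longleftrightarrow>
            (\<exists>B \<in> carrier_mat n n. incidence_mat Q * B = incidence_mat Qt \<and>
               incidence_mat (inverse_quiver Qt) * transpose_mat B
                 = incidence_mat (inverse_quiver Q))) \<and>
         (coxeter_laplacian Q = coxeter_laplacian Qt \<longleftrightarrow>
            (\<exists>B \<in> carrier_mat n n. incidence_mat Q * B = incidence_mat Qt \<and>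
               upper_gram_mat Qt = transpose_mat B * upper_gram_mat Q * B)) \<and>
         (\<forall>B \<in> carrier_mat n n. incidence_mat Q * B = incidence_mat Qt \<and>
            upper_gram_mat Qt = transpose_mat B * upper_gram_mat Q * B \<longrightarrow> invertible_mat B)"
proof -
  define E E' where "E = incidence_mat Q" and "E' = incidence_mat Qt"
  define U U' where "U = upper_gram_mat Q" and "U' = upper_gram_mat Qt"
  define V V' where "V = mat_inv U" and "V' = mat_inv U'"
  note E = incidence_mat_carrier[OF assms(1), folded E_def]
    and E' = incidence_mat_carrier[OF assms(4), folded E'_def]
  note U = upper_gram_mat(1)[OF assms(1,2), folded U_def]
    and U' = upper_gram_mat(1)[OF assms(4,5), folded U'_def]
  note V = mat_inv_upper_gram_mat[OF assms(1,2), folded U_def, folded V_def]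
    and V' = mat_inv_upper_gram_mat[OF assms(4,5), folded U'_def, folded V'_def]
  note inv = inverse_quiver(2)[OF assms(1,2), folded E_def U_def, folded V_def]
    and inv' = inverse_quiver(2)[OF assms(4,5), folded E'_def U'_def, folded V'_def]
  let ?i = "coxeter_laplacian Q = coxeter_laplacian Qt"
  let ?ii = "\<lambda>B. E * B = E' \<and> E' * V' * transpose_mat B = E * V"
  let ?iii = "\<lambda>B. E * B = E' \<and> U' = transpose_mat B * U * B"
  have i_iii: "\<exists>B\<in>carrier_mat n n. ?iii B" if ?i
    using coxeter_laplacian_eq_imp_congruence[OF assms that] by (simp add: E_def E'_def U_def U'_def)
  \<comment> \<open>From \<open>U' = transpose_mat B * U * B\<close> follows
    \<open>V' * transpose_mat B = C * V\<close> with \<open>C\<close> the inverse of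
    \<open>B\<close>; multiplying by \<open>E' = E * B\<close> on the left cancels
    \<open>C\<close>.\<close>
  have iii_ii: "?ii B \<and> invertible_mat B" if B: "B \<in> carrier_mat n n" and iii: "?iii B" for B
  proof -
    obtain C where C: "C \<in> carrier_mat n n" "B * C = 1\<^sub>m n" "C * B = 1\<^sub>m n"
      using iii by (elim conjE) (rule congruence_inverse[OF U B V'(1,2)])
    then have inv: "invertible_mat B" using B by (auto simp: invertible_mat_def inverts_mat_def)
    have T: "transpose_mat B \<in> carrier_mat n n" using B by simp
    have UB: "transpose_mat B * (U * B) = U'"
      using iii assoc_mult_mat[OF T U B] by simp
    have CV: "C * V \<in> carrier_mat n n" using C V by simp
    have "U * B * (C * V) = 1\<^sub>m n"
    proof -
      have "B * (C * V) = V" using assoc_mult_mat[OF B C(1) V(1)] C(2) V(1) by simp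
      then show ?thesis using assoc_mult_mat[OF U B CV] V(2) by simp
    qed
    then have "U' * (C * V) = transpose_mat B"
      using UB assoc_mult_mat[of "transpose_mat B" n n "U * B" n "C * V" n] T U B CV by simp
    then have "V' * transpose_mat B = V' * U' * (C * V)"
      using assoc_mult_mat[OF V'(1) U' CV] by simp
    then have "V' * transpose_mat B = C * V" by (simp only: V'(3) left_mult_one_mat[OF CV])
    then have "E' * V' * transpose_mat B = E' * (C * V)"
      using assoc_mult_mat[OF E' V'(1) T] by simp
    also have "\<dots> = E * (B * (C * V))"
      using iii assoc_mult_mat[OF E B CV] by simp
    also have "B * (C * V) = V"
      using assoc_mult_mat[OF B C(1) V(1)] C(2) V(1) by simp
    finally show ?thesis using iii inv by blast
  qed
  \<comment> \<open>Only one factor \<open>E'\<close> is replaced by \<open>E * B\<close>, namely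
    the transposed one; the matrix \<open>transpose_mat B\<close> so produced is absorbed by the
    second equation.\<close>
  have ii_i: ?i if B: "B \<in> carrier_mat n n" and ii: "?ii B" for B
  proof -
    have "transpose_mat E' = transpose_mat B * transpose_mat E"
      using ii transpose_mult[OF E B] by simp
    then have "E' * V' * transpose_mat E' = E' * V' * transpose_mat B * transpose_mat E"
      using E E' V' B assoc_mult_mat[of "E' * V'" m n "transpose_mat B" n "transpose_mat E" m] by simp
    then show ?thesis
      using assms(1,4) ii by (simp add: coxeter_laplacian_def quiver_def E_def E'_def U_def U'_def V_def V'_def)
  qed
  show ?thesis
    unfolding inv inv' E_def[symmetric] E'_def[symmetric] U_def[symmetric] U'_def[symmetric]
    using i_iii iii_ii ii_i by blast
qed

end
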